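(* Consider an $[[n,1,d]]$ stabilizer code with logical basis states $|0_L\rangle,|1_L\rangle$, let $0\le\lambda\le 1/2$, and consider the state $|\psi_{\mathrm{enc}}\rangle=\sqrt{\lambda}\,|0\rangle_T|0_L\rangle+\sqrt{1-\lambda}\,|1\rangle_T|1_L\rangle$. Let $A\subseteq\{1,\dots,n\}$ be an erasure-correctable subset of the physical qubits. Then $A$ possesses no unique information: for every nonempty subset $B$ of the physical qubits disjoint from $A$ (with $A$ nonempty), the C-PID of the reduced state $\rho_{TAB}$ of $|\psi_{\mathrm{enc}}\rangle$ satisfies $C_{\mathrm{unq}A}=0$.
   Context: Stabilizer codes: $S$ is an abelian subgroup of the $n$-qubit Pauli group with $-\mathbb{1}\notin S$ and $n-1$ independent generators; the codespace is the simultaneous $+1$ eigenspace of $S$ (dimension 2), and $d$ is the code distance. Anticommuting Hermitian Pauli operators $\bar Z,\bar X$ commuting with all of $S$ but not in $S$ are fixed, and $|0_L\rangle,|1_L\rangle$ are the $+1$ and $-1$ eigenvectors of $\bar Z$ in the codespace. A subset $A$ is erasure-correctable if there is a quantum channel $\mathcal{R}$, acting on the qubits outside $A$, such that $\mathcal{R}(\mathrm{Tr}_A|\psi\rangle\langle\psi|)=|\psi\rangle\langle\psi|$ for every unit vector $|\psi\rangle$ in the codespace. C-PID of $\rho_{TAB}$ ($T$ a qubit): $H(\cdot)$ is the von Neumann entropy with base-2 logarithm. Let $\sigma_x,\sigma_y,\sigma_z$ be the Pauli matrices on $T$ with respect to the eigenbasis $\{|0\rangle,|1\rangle\}$ of $\rho_T$;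 $\sigma_x^{\phi}=\cos\phi\,\sigma_x+\sin\phi\,\sigma_y$. For $R\in\{A,B\}$: $C_R=1+H(\rho_R)-H(\rho_{TR})$. For a Hermitian unitary $\sigma$ on $T$, $\Phi_\sigma(\rho_{TR})=\frac12\left(\rho_{TR}+(\sigma\otimes\mathbb{1})\rho_{TR}(\sigma\otimes\mathbb{1})\right)$; $\mathcal{C}_R^{\parallel}=H(\Phi_{\sigma_z}(\rho_{TR}))-H(\rho_{TR})$; $\mathcal{C}_R^{\perp}=\frac1{2\pi}\int_0^{2\pi}[H(\Phi_{\sigma_x^{\phi}}(\rho_{TR}))-H(\rho_{TR})]\,d\phi$. $\Gamma_A=\max(\mathcal{C}_A^{\parallel}-\mathcal{C}_B^{\parallel},0)+\max(\mathcal{C}_A^{\perp}-\mathcal{C}_B^{\perp},0)$, $\Gamma_B$ the same with $A,B$ exchanged; $\Delta_A=(C_A-C_B)-(\Gamma_A-\Gamma_B)$, $\Delta_B=-\Delta_A$; $\gamma_A=\Gamma_A+\min(\Delta_A,0)$, $\gamma_B=\Gamma_B+\min(\Delta_B,0)$. The unique capacity (unique information) of $A$ with respect to $B$ is $C_{\mathrm{unq}A}=\max(\gamma_A,0)-\min(\gamma_B,0)$. *)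

theory Defs
  imports
    "HOL-Analysis.Analysis"
    "HOL-Algebra.Generated_Groups"
    "Jordan_Normal_Form.Schur_Decomposition"
begin

unbundle no vec_syntax
hide_const (open) Finite_Cartesian_Product.vec Finite_Cartesian_Product.mat
  Finite_Cartesian_Product.row Finite_Cartesian_Product.column

section \<open>Registers of qubits\<close>

text \<open>
  Qubits are named by natural numbers and a register is a finite set \<open>Q\<close> of qubits.  Its state space
  is \<open>\<complex>\<close> to the power \<open>2 ^ card Q\<close>; the computational basis vector with index \<open>i\<close> is the bit string
  whose value at the qubit \<open>q \<in> Q\<close> is the binary digit of \<open>i\<close> at the position of \<open>q\<close> in the increasing
  enumeration of \<open>Q\<close> (so the smallest qubit carries the least significant bit).  In the main theorem
  the physical qubits are \<open>{1..n}\<close> and the target \<open>T\<close> is the qubit \<open>0\<close>.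
\<close>

definition reg_dim :: "nat set \<Rightarrow> nat" where
  "reg_dim Q = 2 ^ card Q"

definition digit :: "nat set \<Rightarrow> nat \<Rightarrow> nat \<Rightarrow> nat" where
  "digit Q i q = (i div 2 ^ card {r \<in> Q. r < q}) mod 2"

definition basis_index :: "nat set \<Rightarrow> (nat \<Rightarrow> nat) \<Rightarrow> nat" where
  "basis_index Q b = (\<Sum>q\<in>Q. b q * 2 ^ card {r \<in> Q. r < q})"

definition tensor_op :: "nat set \<Rightarrow> (nat \<Rightarrow> complex mat) \<Rightarrow> complex mat" where
  "tensor_op Q f = Matrix.mat (reg_dim Q) (reg_dim Q)
     (\<lambda>(i, j). \<Prod>q\<in>Q. f q $$ (digit Q i q, digit Q j q))"

definition tensor_vec :: "nat set \<Rightarrow> nat set \<Rightarrow> complex vec \<Rightarrow> complex vec \<Rightarrow> complex vec" where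
  "tensor_vec K L u v = Matrix.vec (reg_dim (K \<union> L))
     (\<lambda>i. u $ basis_index K (digit (K \<union> L) i) * v $ basis_index L (digit (K \<union> L) i))"

definition ket_bra :: "complex vec \<Rightarrow> complex mat" where
  "ket_bra v = Matrix.mat (dim_vec v) (dim_vec v) (\<lambda>(i, j). v $ i * cnj (v $ j))"

text \<open>\<open>reduced_state Q K \<rho>\<close> is the reduced state on \<open>K \<subseteq> Q\<close> of the state \<open>\<rho>\<close> of \<open>Q\<close>: the qubits in
  \<open>Q - K\<close> are traced out.\<close>

definition reduced_state :: "nat set \<Rightarrow> nat set \<Rightarrow> complex mat \<Rightarrow> complex mat" where
  "reduced_state Q K \<rho> =
     (let join = (\<lambda>i e. basis_index Q (\<lambda>q. if q \<in> K then digit K i q else digit (Q - K) e q))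
      in Matrix.mat (reg_dim K) (reg_dim K)
           (\<lambda>(i, j). \<Sum>e<reg_dim (Q - K). \<rho> $$ (join i e, join j e)))"


section \<open>Quantum channels\<close>

definition positive_op :: "nat \<Rightarrow> complex mat \<Rightarrow> bool" where
  "positive_op d M \<longleftrightarrow> M \<in> carrier_mat d d \<and> (\<forall>v\<in>carrier_vec d. 0 \<le> (M *\<^sub>v v) \<bullet>c v)"

text \<open>\<open>amplify k d e R\<close> is \<open>id\<^sub>k \<otimes> R\<close>: it applies \<open>R\<close> to each of the \<open>k \<times> k\<close> blocks (of size \<open>d \<times> d\<close>)
  of its argument.\<close>

definition amplify ::
  "nat \<Rightarrow> nat \<Rightarrow> nat \<Rightarrow> (complex mat \<Rightarrow> complex mat) \<Rightarrow> complex mat \<Rightarrow> complex mat" where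
  "amplify k d e R M = Matrix.mat (k * e) (k * e) (\<lambda>(i, j).
     R (Matrix.mat d d (\<lambda>(a, b). M $$ ((i div e) * d + a, (j div e) * d + b)))
       $$ (i mod e, j mod e))"

definition quantum_channel :: "nat \<Rightarrow> nat \<Rightarrow> (complex mat \<Rightarrow> complex mat) \<Rightarrow> bool" where
  "quantum_channel d e R \<longleftrightarrow>
     (\<forall>M\<in>carrier_mat d d. R M \<in> carrier_mat e e) \<and>
     (\<forall>M\<in>carrier_mat d d. \<forall>N\<in>carrier_mat d d. R (M + N) = R M + R N) \<and>
     (\<forall>c. \<forall>M\<in>carrier_mat d d. R (c \<cdot>\<^sub>m M) = c \<cdot>\<^sub>m R M) \<and>
     (\<forall>M\<in>carrier_mat d d. (\<Sum>i<e. R M $$ (i, i)) = (\<Sum>i<d. M $$ (i, i))) \<and>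
     (\<forall>k M. positive_op (k * d) M \<longrightarrow> positive_op (k * e) (amplify k d e R M))"


section \<open>The Pauli group and stabilizer codes\<close>

definition sigma_x :: "complex mat" where
  "sigma_x = mat_of_rows_list 2 [[0, 1], [1, 0]]"

definition sigma_y :: "complex mat" where
  "sigma_y = mat_of_rows_list 2 [[0, - \<i>], [\<i>, 0]]"

definition sigma_z :: "complex mat" where
  "sigma_z = mat_of_rows_list 2 [[1, 0], [0, - 1]]"

datatype pauli = PauliI | PauliX | PauliY | PauliZ

fun pauli_mat :: "pauli \<Rightarrow> complex mat" where
  "pauli_mat PauliI = 1\<^sub>m 2"
| "pauli_mat PauliX = sigma_x"
| "pauli_mat PauliY = sigma_y"
| "pauli_mat PauliZ = sigma_z"

definition pauli_string :: "nat \<Rightarrow> (nat \<Rightarrow> pauli) \<Rightarrow> complex mat" where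
  "pauli_string n P = tensor_op {1..n} (\<lambda>q. pauli_mat (P q))"

definition pauli_weight :: "nat \<Rightarrow> (nat \<Rightarrow> pauli) \<Rightarrow> nat" where
  "pauli_weight n P = card {q \<in> {1..n}. P q \<noteq> PauliI}"

definition pauli_group :: "nat \<Rightarrow> complex mat monoid" where
  "pauli_group n =
     \<lparr>carrier = {c \<cdot>\<^sub>m pauli_string n P | c P. c \<in> {1, - 1, \<i>, - \<i>}}, mult = (*), one = 1\<^sub>m (2 ^ n)\<rparr>"

definition codespace :: "nat \<Rightarrow> complex mat set \<Rightarrow> complex vec set" where
  "codespace n S = {v \<in> carrier_vec (2 ^ n). \<forall>s\<in>S. s *\<^sub>v v = v}"

text \<open>The code distance is the least weight of a Pauli string that commutes with all of \<open>S\<close> but is not,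
  up to a phase, in \<open>S\<close>.\<close>

definition code_distance :: "nat \<Rightarrow> complex mat set \<Rightarrow> nat" where
  "code_distance n S = (LEAST w. \<exists>P. pauli_weight n P = w \<and>
     (\<forall>s\<in>S. pauli_string n P * s = s * pauli_string n P) \<and>
     (\<forall>c\<in>{1, - 1, \<i>, - \<i>}. c \<cdot>\<^sub>m pauli_string n P \<notin> S))"

text \<open>\<open>S\<close> is the stabilizer group of an \<open>[[n,1,d]]\<close> code.\<close>

definition stabilizer_code :: "nat \<Rightarrow> nat \<Rightarrow> complex mat set \<Rightarrow> bool" where
  "stabilizer_code n d S \<longleftrightarrow>
     1 \<le> n \<and>
     subgroup S (pauli_group n) \<and>
     (\<forall>s\<in>S. \<forall>t\<in>S. s * t = t * s) \<and>
     - 1\<^sub>m (2 ^ n) \<notin> S \<and>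
     (\<exists>gens. finite gens \<and> gens \<subseteq> carrier (pauli_group n) \<and> card gens = n - 1 \<and>
        generate (pauli_group n) gens = S \<and>
        (\<forall>g\<in>gens. g \<notin> generate (pauli_group n) (gens - {g}))) \<and>
     d = code_distance n S"

definition logical_op :: "nat \<Rightarrow> complex mat set \<Rightarrow> complex mat \<Rightarrow> bool" where
  "logical_op n S L \<longleftrightarrow>
     L \<in> carrier (pauli_group n) \<and> mat_adjoint L = L \<and> (\<forall>s\<in>S. L * s = s * L) \<and> L \<notin> S"

definition logical_basis ::
  "nat \<Rightarrow> complex mat set \<Rightarrow> complex mat \<Rightarrow> complex vec \<Rightarrow> complex vec \<Rightarrow> bool" where
  "logical_basis n S Zbar v0 v1 \<longleftrightarrow>
     v0 \<in> codespace n S \<and> v0 \<bullet>c v0 = 1 \<and> Zbar *\<^sub>v v0 = v0 \<and>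
     v1 \<in> codespace n S \<and> v1 \<bullet>c v1 = 1 \<and> Zbar *\<^sub>v v1 = - v1"

definition erasure_correctable :: "nat \<Rightarrow> complex mat set \<Rightarrow> nat set \<Rightarrow> bool" where
  "erasure_correctable n S A \<longleftrightarrow>
     (\<exists>R. quantum_channel (reg_dim ({1..n} - A)) (2 ^ n) R \<and>
        (\<forall>v\<in>codespace n S. v \<bullet>c v = 1 \<longrightarrow>
           R (reduced_state {1..n} ({1..n} - A) (ket_bra v)) = ket_bra v))"

definition encoded_state :: "nat \<Rightarrow> real \<Rightarrow> complex vec \<Rightarrow> complex vec \<Rightarrow> complex vec" where
  "encoded_state n lam v0 v1 =
     complex_of_real (sqrt lam) \<cdot>\<^sub>v tensor_vec {0} {1..n} (unit_vec 2 0) v0 +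
     complex_of_real (sqrt (1 - lam)) \<cdot>\<^sub>v tensor_vec {0} {1..n} (unit_vec 2 1) v1"


section \<open>The C-PID of a state\<close>

text \<open>Von Neumann entropy in bits; the roots of the characteristic polynomial are the eigenvalues with
  multiplicity.  The convention \<open>0 * log 0 = 0\<close> is automatic.\<close>

definition vn_entropy :: "complex mat \<Rightarrow> real" where
  "vn_entropy \<rho> = - (\<Sum>a\<in>#proots (char_poly \<rho>). Re a * log 2 (Re a))"

text \<open>
  In this section \<open>\<rho>\<close> is a state of the register \<open>Q\<close>, which consists of the target qubit \<open>0\<close> and of the
  qubits in \<open>A\<close> and \<open>B\<close>.  The Pauli matrices on the target are those of its computational basis, so the
  C-PID is meaningful only for states whose reduced state on the target is diagonal in that basis.
  For \<open>encoded_state n lam v0 v1\<close> with \<open>logical_basis\<close> vectors \<open>v0\<close>, \<open>v1\<close> this reduced state is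
  \<open>diag(lam, 1 - lam)\<close>.
\<close>

definition sigma_phi :: "real \<Rightarrow> complex mat" where
  "sigma_phi \<phi> = complex_of_real (cos \<phi>) \<cdot>\<^sub>m sigma_x + complex_of_real (sin \<phi>) \<cdot>\<^sub>m sigma_y"

definition capacity :: "nat set \<Rightarrow> complex mat \<Rightarrow> nat set \<Rightarrow> real" where
  "capacity Q \<rho> R =
     1 + vn_entropy (reduced_state Q R \<rho>) - vn_entropy (reduced_state Q (insert 0 R) \<rho>)"

definition on_target :: "nat set \<Rightarrow> complex mat \<Rightarrow> complex mat" where
  "on_target R \<sigma> = tensor_op (insert 0 R) (\<lambda>q. if q = 0 then \<sigma> else 1\<^sub>m 2)"

definition dephase :: "nat set \<Rightarrow> complex mat \<Rightarrow> complex mat \<Rightarrow> complex mat" where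
  "dephase R \<sigma> \<rho> = (1 / 2) \<cdot>\<^sub>m (\<rho> + on_target R \<sigma> * \<rho> * on_target R \<sigma>)"

definition coherence :: "nat set \<Rightarrow> complex mat \<Rightarrow> nat set \<Rightarrow> complex mat \<Rightarrow> real" where
  "coherence Q \<rho> R \<sigma> =
     vn_entropy (dephase R \<sigma> (reduced_state Q (insert 0 R) \<rho>)) - vn_entropy (reduced_state Q (insert 0 R) \<rho>)"

definition C_par :: "nat set \<Rightarrow> complex mat \<Rightarrow> nat set \<Rightarrow> real" where
  "C_par Q \<rho> R = coherence Q \<rho> R sigma_z"

definition C_perp :: "nat set \<Rightarrow> complex mat \<Rightarrow> nat set \<Rightarrow> real" where
  "C_perp Q \<rho> R = 1 / (2 * pi) * integral {0..2 * pi} (\<lambda>\<phi>. coherence Q \<rho> R (sigma_phi \<phi>))"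

text \<open>In the following quantities the pair \<open>A\<close>, \<open>B\<close> is ordered: the quantities of the source \<open>B\<close> are
  obtained by exchanging the two arguments.\<close>

definition Gamma_cap :: "nat set \<Rightarrow> complex mat \<Rightarrow> nat set \<Rightarrow> nat set \<Rightarrow> real" where
  "Gamma_cap Q \<rho> A B =
     max (C_par Q \<rho> A - C_par Q \<rho> B) 0 + max (C_perp Q \<rho> A - C_perp Q \<rho> B) 0"

definition Delta_cap :: "nat set \<Rightarrow> complex mat \<Rightarrow> nat set \<Rightarrow> nat set \<Rightarrow> real" where
  "Delta_cap Q \<rho> A B =
     (capacity Q \<rho> A - capacity Q \<rho> B) - (Gamma_cap Q \<rho> A B - Gamma_cap Q \<rho> B A)"

definition gamma_cap :: "nat set \<Rightarrow> complex mat \<Rightarrow> nat set \<Rightarrow> nat set \<Rightarrow> real" where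
  "gamma_cap Q \<rho> A B = Gamma_cap Q \<rho> A B + min (Delta_cap Q \<rho> A B) 0"

definition unique_capacity :: "nat set \<Rightarrow> nat set \<Rightarrow> complex mat \<Rightarrow> real" where
  "unique_capacity A B \<rho> =
     (let Q = insert 0 (A \<union> B)
      in max (gamma_cap Q \<rho> A B) 0 - min (gamma_cap Q \<rho> B A) 0)"

end

theory Submission
  imports Defs
begin

text \<open>
  A recovery channel for the erasure of \<open>A\<close> sends the \<open>A\<close>-complement part of a code state to a pure
  state, so, by complete positivity, the output is in product form with \<open>A\<close>.  Comparing the phases of
  this identity over the superpositions of \<open>v0\<close> and \<open>v1\<close> shows that \<open>A\<close> carries no information on the
  logical qubit: \<open>\<rho>\<^sub>T\<^sub>A = diag(lam, 1 - lam) \<otimes> \<sigma>\<close>.  Hence the parallel contribution of \<open>A\<close> vanishes and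
  its perpendicular contribution equals its capacity \<open>1 - h(lam)\<close>.  For \<open>B\<close> nothing but
  \<open>0 \<le> C_par B \<le> capacity B - capacity A\<close> is needed, and both inequalities are instances of Gibbs'
  inequality: pinching does not decrease the entropy, and the entropy of the pinched state is
  subadditive.  Whatever the value of \<open>C_perp B\<close>, this gives \<open>gamma_cap A B \<le> 0 \<le> gamma_cap B A\<close>.
\<close>

section \<open>Registers and partial traces\<close>

text \<open>The recovery hypothesis speaks of single code states without a reference system, so the
  Knill-Laflamme conditions cannot be read off from it. The spectator on which complete positivity
  is used is \<open>A\<close> itself: a code vector is cut into pieces labelled by the basis index
  of \<open>A\<close>, and the channel acts on the pieces. The scalar factors obtained in this way
  still depend on the code state, quadratically in its amplitudes. Recovery of the basis states
  alone would allow \<open>A\<close> to hold a classical copy of the logical bit; superpositions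
  with complex phases exclude this. \<open>C_perp\<close> is an integral, but for \<open>A\<close>
  the integrand is constant: dephasing along any equatorial axis turns a diagonal target factor into
  the maximally mixed one. For \<open>B\<close> the integral is never evaluated: each
  \<open>gamma_cap\<close> is a minimum of two terms that contain \<open>C_perp B\<close> only
  through the positive or the negative part of \<open>C_perp A - C_perp B\<close>. Entropy is
  defined by the roots of the characteristic polynomial, so all entropy estimates are made with
  explicit eigenbases.\<close>

lemma digit_less_2 [simp]: "digit Q i q < 2"
  by (simp add: digit_def)

lemma basis_index_cong: "(\<And>q. q \<in> Q \<Longrightarrow> b q = b' q) \<Longrightarrow> basis_index Q b = basis_index Q b'"
  by (simp add: basis_index_def)

text \<open>Inductions on a register add a new largest qubit: it becomes the most significant bit
  and leaves the ranks of the other qubits unchanged.\<close>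

lemma rank_insert_max:
  fixes m :: nat
  assumes "\<forall>q\<in>Q. q < m" and "q \<in> Q"
  shows "{r \<in> insert m Q. r < q} = {r \<in> Q. r < q}"
  using assms order_less_asym by auto

lemma rank_insert_max':
  fixes m :: nat
  assumes "\<forall>q\<in>Q. q < m"
  shows "{r \<in> insert m Q. r < m} = Q"
  using assms by auto

lemma basis_index_insert_max:
  assumes "finite Q" and "\<forall>q\<in>Q. q < m"
  shows "basis_index (insert m Q) b = basis_index Q b + b m * 2 ^ card Q"
proof -
  have "m \<notin> Q" using assms by auto
  moreover have "(\<Sum>q\<in>Q. b q * 2 ^ card {r \<in> insert m Q. r < q}) = basis_index Q b"
    unfolding basis_index_def using rank_insert_max[OF assms(2)] by (intro sum.cong) auto
  ultimately show ?thesis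
    using assms(1) rank_insert_max'[OF assms(2)] by (simp add: basis_index_def)
qed

lemma digit_insert_max:
  assumes "finite Q" and "\<forall>q\<in>Q. q < m" and "q \<in> Q"
  shows "digit (insert m Q) i q = digit Q (i mod 2 ^ card Q) q"
proof -
  have "{r \<in> Q. r < q} \<subset> Q" using assms(3) by auto
  then have "card {r \<in> Q. r < q} < card Q" using assms(1) by (rule psubset_card_mono[rotated])
  then have "bit (take_bit (card Q) i) (card {r \<in> Q. r < q}) = bit i (card {r \<in> Q. r < q})"
    by (simp add: bit_take_bit_iff)
  then show ?thesis
    unfolding digit_def rank_insert_max[OF assms(2,3)]
    by (simp add: bit_iff_odd take_bit_eq_mod mod_2_eq_odd)
qed

lemma digit_insert_max':
  assumes "\<forall>q\<in>Q. q < m"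
  shows "digit (insert m Q) i m = (i div 2 ^ card Q) mod 2"
  unfolding digit_def rank_insert_max'[OF assms] ..

lemma basis_index_less:
  assumes "finite Q" and "\<And>q. q \<in> Q \<Longrightarrow> b q < 2"
  shows "basis_index Q b < reg_dim Q"
  using assms
proof (induction Q rule: finite_linorder_max_induct)
  case empty
  then show ?case by (simp add: basis_index_def reg_dim_def)
next
  case (insert m Q)
  have "m \<notin> Q" using insert by auto
  have "b m \<le> 1" using insert.prems[of m] by simp
  then have "b m * 2 ^ card Q \<le> 2 ^ card Q" by simp
  moreover have "basis_index Q b < reg_dim Q" using insert by auto
  ultimately have "basis_index Q b + b m * 2 ^ card Q < 2 * 2 ^ card Q"
    unfolding reg_dim_def by linarith
  then show ?case
    using insert.hyps \<open>m \<notin> Q\<close> by (simp add: basis_index_insert_max reg_dim_def)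
qed

lemma digit_basis_index:
  assumes "finite Q" and "\<And>q. q \<in> Q \<Longrightarrow> b q < 2" and "q \<in> Q"
  shows "digit Q (basis_index Q b) q = b q"
  using assms
proof (induction Q arbitrary: q rule: finite_linorder_max_induct)
  case empty
  then show ?case by simp
next
  case (insert m Q)
  have less: "basis_index Q b < 2 ^ card Q"
    using basis_index_less[of Q b] insert by (simp add: reg_dim_def)
  have "b m < 2" using insert.prems by auto
  show ?case
  proof (cases "q = m")
    case True
    then show ?thesis
      using insert.hyps less \<open>b m < 2\<close> by (simp add: basis_index_insert_max digit_insert_max')
  next
    case False
    then have "q \<in> Q" using insert.prems by auto
    then show ?thesis
      using insert less by (simp add: basis_index_insert_max digit_insert_max)
  qed
qed

lemma basis_index_digit:
  assumes "finite Q" and "i < reg_dim Q"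
  shows "basis_index Q (digit Q i) = i"
  using assms
proof (induction Q arbitrary: i rule: finite_linorder_max_induct)
  case empty
  then show ?case by (simp add: basis_index_def reg_dim_def)
next
  case (insert m Q)
  have "m \<notin> Q" using insert by auto
  have "i div 2 ^ card Q < 2"
    using insert \<open>m \<notin> Q\<close> by (simp add: reg_dim_def less_mult_imp_div_less)
  moreover have "basis_index Q (digit (insert m Q) i) = basis_index Q (digit Q (i mod 2 ^ card Q))"
    using insert.hyps by (intro basis_index_cong digit_insert_max) auto
  moreover have "\<dots> = i mod 2 ^ card Q"
    by (intro insert.IH) (simp add: reg_dim_def)
  ultimately show ?case
    using insert.hyps by (simp add: basis_index_insert_max digit_insert_max' mod_div_mult_eq)
qed

lemma digit_inject:
  assumes "finite Q" and "i < reg_dim Q" and "j < reg_dim Q" and "\<And>q. q \<in> Q \<Longrightarrow> digit Q i q = digit Q j q"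
  shows "i = j"
  using basis_index_cong[of Q "digit Q i" "digit Q j"] basis_index_digit assms by metis

section \<open>Gluing bit strings and composing partial traces\<close>

definition join_index :: "nat set \<Rightarrow> nat set \<Rightarrow> nat \<Rightarrow> nat \<Rightarrow> nat" where
  "join_index Q K i e = basis_index Q (\<lambda>q. if q \<in> K then digit K i q else digit (Q - K) e q)"

lemma reduced_state_carrier [simp]: "reduced_state Q K \<rho> \<in> carrier_mat (reg_dim K) (reg_dim K)"
  by (simp add: reduced_state_def Let_def)

lemma reduced_state_entry:
  "i < reg_dim K \<Longrightarrow> j < reg_dim K \<Longrightarrow> reduced_state Q K \<rho> $$ (i, j) =
     (\<Sum>e<reg_dim (Q - K). \<rho> $$ (join_index Q K i e, join_index Q K j e))"
  by (simp add: reduced_state_def Let_def join_index_def)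

lemma join_index_less: "finite Q \<Longrightarrow> join_index Q K i e < reg_dim Q"
  unfolding join_index_def by (intro basis_index_less) auto

lemma digit_join_index:
  "finite Q \<Longrightarrow> q \<in> Q \<Longrightarrow> digit Q (join_index Q K i e) q = (if q \<in> K then digit K i q else digit (Q - K) e q)"
  unfolding join_index_def by (subst digit_basis_index) auto

text \<open>A bit string on \<open>Q\<close> is a pair of bit strings on \<open>K\<close> and
  \<open>Q - K\<close>; the inverse map reads off the two restrictions.\<close>

lemma bij_betw_join_index:
  assumes "finite Q" and "K \<subseteq> Q"
  shows "bij_betw (\<lambda>(i, e). join_index Q K i e) ({..<reg_dim K} \<times> {..<reg_dim (Q - K)}) {..<reg_dim Q}"
proof (rule bij_betwI[where g = "\<lambda>x. (basis_index K (digit Q x), basis_index (Q - K) (digit Q x))"])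
  have K: "finite K" "finite (Q - K)" using assms finite_subset by auto
  show "(\<lambda>(i, e). join_index Q K i e) \<in> {..<reg_dim K} \<times> {..<reg_dim (Q - K)} \<rightarrow> {..<reg_dim Q}"
    using assms by (auto simp: join_index_less)
  show "(\<lambda>x. (basis_index K (digit Q x), basis_index (Q - K) (digit Q x)))
      \<in> {..<reg_dim Q} \<rightarrow> {..<reg_dim K} \<times> {..<reg_dim (Q - K)}"
    using K by (auto intro!: basis_index_less)
  show "(basis_index K (digit Q ((\<lambda>(i, e). join_index Q K i e) x)),
      basis_index (Q - K) (digit Q ((\<lambda>(i, e). join_index Q K i e) x))) = x"
    if x: "x \<in> {..<reg_dim K} \<times> {..<reg_dim (Q - K)}" for x
  proof -
    obtain i e where ie: "x = (i, e)" "i < reg_dim K" "e < reg_dim (Q - K)" using x by auto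
    have "basis_index K (digit Q (join_index Q K i e)) = basis_index K (digit K i)"
      "basis_index (Q - K) (digit Q (join_index Q K i e)) = basis_index (Q - K) (digit (Q - K) e)"
      using assms by (auto intro!: basis_index_cong simp: digit_join_index)
    then show ?thesis using ie K by (simp add: basis_index_digit)
  qed
  show "(\<lambda>(i, e). join_index Q K i e) (basis_index K (digit Q x), basis_index (Q - K) (digit Q x)) = x"
    if x: "x \<in> {..<reg_dim Q}" for x
  proof -
    have "join_index Q K (basis_index K (digit Q x)) (basis_index (Q - K) (digit Q x)) = basis_index Q (digit Q x)"
      unfolding join_index_def using K by (intro basis_index_cong) (auto simp: digit_basis_index)
    then show ?thesis using x assms by (simp add: basis_index_digit)
  qed
qed

lemma sum_join_index:
  assumes "finite Q" and "K \<subseteq> Q"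
  shows "(\<Sum>x<reg_dim Q. F x) = (\<Sum>i<reg_dim K. \<Sum>e<reg_dim (Q - K). F (join_index Q K i e))"
  unfolding sum.reindex_bij_betw[OF bij_betw_join_index[OF assms], symmetric] sum.cartesian_product
  by (simp add: case_prod_unfold)

text \<open>Gluing is associative: both sides are the bit string with \<open>i\<close> on
  \<open>K\<close>, \<open>e\<close> on \<open>Q - K\<close> and \<open>f\<close> on
  \<open>N - Q\<close>. This is what makes successive partial traces compose.\<close>

lemma join_index_join_index:
  assumes "finite N" and "K \<subseteq> Q" and "Q \<subseteq> N"
  shows "join_index N Q (join_index Q K i e) f = join_index N K i (join_index (N - K) (Q - K) e f)"
proof -
  have *: "N - K - (Q - K) = N - Q" using assms by auto
  have "finite Q" using assms finite_subset by auto
  then show ?thesis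
    unfolding join_index_def[of N] using assms
    by (intro basis_index_cong) (auto simp: digit_join_index *)
qed

lemma reduced_state_reduced_state:
  assumes "finite N" and "K \<subseteq> Q" and "Q \<subseteq> N"
  shows "reduced_state Q K (reduced_state N Q \<rho>) = reduced_state N K \<rho>"
proof (rule eq_matI)
  fix i j assume "i < dim_row (reduced_state N K \<rho>)" "j < dim_col (reduced_state N K \<rho>)"
  then have ij: "i < reg_dim K" "j < reg_dim K" by (simp_all add: reduced_state_def Let_def)
  have *: "N - K - (Q - K) = N - Q" using assms by auto
  have "finite Q" using assms finite_subset by auto
  then show "reduced_state Q K (reduced_state N Q \<rho>) $$ (i, j) = reduced_state N K \<rho> $$ (i, j)"
    using ij assms
    by (simp add: reduced_state_entry join_index_less join_index_join_index
        sum_join_index[of "N - K" "Q - K"] Diff_mono *)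
qed (simp_all add: reduced_state_def Let_def)

section \<open>The target as the least significant bit\<close>

lemma rank_insert_0:
  fixes R :: "nat set"
  assumes "finite R" and "0 \<notin> R" and "q \<in> R"
  shows "card {r \<in> insert 0 R. r < q} = Suc (card {r \<in> R. r < q})"
proof -
  have "q > 0" using assms(2,3) by (cases q) auto
  then have "{r \<in> insert 0 R. r < q} = insert 0 {r \<in> R. r < q}" by auto
  then show ?thesis using assms by simp
qed

lemma basis_index_insert_0:
  assumes "finite R" and "0 \<notin> R"
  shows "basis_index (insert 0 R) b = b 0 + 2 * basis_index R b"
proof -
  have "{r \<in> insert 0 R. r < 0} = {}" by auto
  then have "basis_index (insert 0 R) b = b 0 + (\<Sum>q\<in>R. b q * 2 ^ card {r \<in> insert 0 R. r < q})"
    using assms unfolding basis_index_def by simp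
  also have "(\<Sum>q\<in>R. b q * 2 ^ card {r \<in> insert 0 R. r < q}) = 2 * basis_index R b"
    unfolding basis_index_def sum_distrib_left
    by (intro sum.cong refl) (simp only: rank_insert_0[OF assms] power_Suc mult.left_commute)
  finally show ?thesis .
qed

lemma digit_insert_0 [simp]: "digit (insert 0 R) i 0 = i mod 2"
  by (simp add: digit_def)

lemma digit_insert_0':
  assumes "finite R" and "0 \<notin> R" and "q \<in> R"
  shows "digit (insert 0 R) i q = digit R (i div 2) q"
  unfolding digit_def rank_insert_0[OF assms] by (simp add: div_mult2_eq)

lemma reg_dim_insert_0: "finite R \<Longrightarrow> 0 \<notin> R \<Longrightarrow> reg_dim (insert 0 R) = 2 * reg_dim R"
  by (simp add: reg_dim_def)

lemma join_index_insert_0: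
  assumes "finite Q" and "0 \<notin> Q" and "R \<subseteq> Q" and "t < 2"
  shows "join_index (insert 0 Q) (insert 0 R) (t + 2 * r) e = t + 2 * join_index Q R r e"
proof -
  have R: "finite R" "0 \<notin> R" using assms finite_subset by auto
  have *: "insert 0 Q - insert 0 R = Q - R" using assms by auto
  have "basis_index Q (\<lambda>q. if q \<in> insert 0 R then digit (insert 0 R) (t + 2 * r) q
      else digit (insert 0 Q - insert 0 R) e q) = join_index Q R r e"
    unfolding join_index_def * using R assms
    by (intro basis_index_cong) (auto simp: digit_insert_0')
  then show ?thesis
    using assms unfolding join_index_def[of "insert 0 Q"] by (simp add: basis_index_insert_0)
qed

lemma join_index_target:
  assumes "finite R" and "0 \<notin> R" and "r < reg_dim R" and "t < 2"
  shows "join_index (insert 0 R) R r t = t + 2 * r"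
proof -
  have *: "insert 0 R - R = {0}" using assms by auto
  have "basis_index R (\<lambda>q. if q \<in> R then digit R r q else digit {0} t q) = r"
    using basis_index_cong[of R _ "digit R r"] basis_index_digit[OF assms(1,3)] by auto
  then show ?thesis
    using assms unfolding join_index_def * by (simp add: basis_index_insert_0)
qed


section \<open>Spectral theorem for Hermitian matrices\<close>

lemma dim_mat_adjoint [simp]:
  "dim_row (mat_adjoint A) = dim_col A" "dim_col (mat_adjoint A) = dim_row A"
  by (auto simp: mat_adjoint_def)

lemma mat_adjoint_carrier [simp]: "A \<in> carrier_mat n m \<Longrightarrow> mat_adjoint A \<in> carrier_mat m n"
  by auto

lemma mat_adjoint_entry [simp]:
  "i < dim_col A \<Longrightarrow> j < dim_row A \<Longrightarrow> mat_adjoint A $$ (i, j) = conjugate (A $$ (j, i))"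
  by (auto simp: mat_adjoint_def mat_of_rows_def)

lemma mat_adjoint_adjoint [simp]: "mat_adjoint (mat_adjoint A) = (A :: complex mat)"
  by (rule eq_matI) auto

lemma mat_adjoint_mult:
  assumes "A \<in> carrier_mat n m" and "B \<in> carrier_mat m k"
  shows "mat_adjoint (A * B) = mat_adjoint B * mat_adjoint (A :: complex mat)"
  using assms by (intro eq_matI) (auto simp: scalar_prod_def mult.commute)

text \<open>For square matrices the inner dimension is fixed by the goal, so that carrier conditions
  of long products can be discharged by rewriting; the general rule leaves it undetermined.\<close>

lemma mult_carrier_square_mat:
  "A \<in> carrier_mat n n \<Longrightarrow> B \<in> carrier_mat n n \<Longrightarrow> A * B \<in> carrier_mat n n"
  by (rule mult_carrier_mat)

lemma mat_adjoint_mult_square: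
  "A \<in> carrier_mat n n \<Longrightarrow> B \<in> carrier_mat n n \<Longrightarrow>
   mat_adjoint (A * B) = mat_adjoint B * mat_adjoint (A :: complex mat)"
  by (rule mat_adjoint_mult)

lemmas square_mat_simps = mult_carrier_square_mat mat_adjoint_mult_square
  assoc_mult_mat[of _ n n _ n _ n for n]

definition unitary_mat :: "nat \<Rightarrow> complex mat \<Rightarrow> bool" where
  "unitary_mat n U \<longleftrightarrow> U \<in> carrier_mat n n \<and> mat_adjoint U * U = 1\<^sub>m n"

definition real_diag :: "nat \<Rightarrow> (nat \<Rightarrow> real) \<Rightarrow> complex mat" where
  "real_diag n l = Matrix.mat n n (\<lambda>(i, j). if i = j then complex_of_real (l i) else 0)"

lemma real_diag_carrier [simp]: "real_diag n l \<in> carrier_mat n n"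
  by (simp add: real_diag_def)

lemma unitary_mat_mult:
  assumes "unitary_mat n U" and "unitary_mat n V"
  shows "unitary_mat n (U * V)"
proof -
  have c: "U \<in> carrier_mat n n" "V \<in> carrier_mat n n" "mat_adjoint U \<in> carrier_mat n n"
    "mat_adjoint V \<in> carrier_mat n n" using assms by (auto simp: unitary_mat_def)
  have "mat_adjoint (U * V) * (U * V) = mat_adjoint V * ((mat_adjoint U * U) * V)"
    using c by (simp add: square_mat_simps[of _ n] del: mult_carrier_mat)
  also have "\<dots> = 1\<^sub>m n" using assms c by (simp add: unitary_mat_def)
  finally show ?thesis using c by (simp add: unitary_mat_def)
qed

lemma unitary_mat_right_inverse:
  assumes "unitary_mat n U"
  shows "U * mat_adjoint U = 1\<^sub>m n"
  using assms mat_mult_left_right_inverse[of "mat_adjoint U" n U]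
  by (auto simp: unitary_mat_def)

lemma mat_adjoint_four_block:
  assumes "A \<in> carrier_mat a b" "B \<in> carrier_mat a d" "C \<in> carrier_mat c b" "D \<in> carrier_mat c d"
  shows "mat_adjoint (four_block_mat A B C D) =
    four_block_mat (mat_adjoint A) (mat_adjoint C) (mat_adjoint B) (mat_adjoint (D :: complex mat))"
  using assms by (intro eq_matI) auto

lemma mult_block_diag:
  assumes "A1 \<in> carrier_mat a a" "A2 \<in> carrier_mat a a" "B1 \<in> carrier_mat b b" "B2 \<in> carrier_mat b b"
  shows "four_block_mat A1 (0\<^sub>m a b) (0\<^sub>m b a) B1 * four_block_mat A2 (0\<^sub>m a b) (0\<^sub>m b a) B2 =
    four_block_mat (A1 * A2) (0\<^sub>m a b) (0\<^sub>m b a) (B1 * (B2 :: complex mat))"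
  unfolding mult_four_block_mat[OF assms(1) zero_carrier_mat zero_carrier_mat assms(3)
      assms(2) zero_carrier_mat zero_carrier_mat assms(4)]
  using assms by (simp add: mult_carrier_square_mat del: mult_carrier_mat)

text \<open>The characteristic polynomial has positive degree and hence a complex root; an
  eigenvector for it is completed to a basis, which is orthogonalised and normalised.\<close>

lemma exists_unitary_with_eigenvector:
  assumes A: "(A :: complex mat) \<in> carrier_mat (Suc n) (Suc n)"
  shows "\<exists>W e. unitary_mat (Suc n) W \<and> A *\<^sub>v Matrix.col W 0 = e \<cdot>\<^sub>v Matrix.col W 0"
proof -
  have "degree (char_poly A) = Suc n" using degree_monic_char_poly[OF A] by simp
  then obtain e where "poly (char_poly A) e = 0"
    using fundamental_theorem_of_algebra[of "char_poly A"] by (auto simp: constant_degree)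
  then have e: "eigenvalue A e" using eigenvalue_root_char_poly[OF A] by simp
  define v where "v = find_eigenvector A e"
  have "eigenvector A v e" using find_eigenvector[OF A e] by (simp add: v_def)
  then have v: "v \<in> carrier_vec (Suc n)" "v \<noteq> 0\<^sub>v (Suc n)" "A *\<^sub>v v = e \<cdot>\<^sub>v v"
    using A by (auto simp: eigenvector_def)
  \<comment> \<open>The completed basis starts with \<open>v\<close>, and Gram-Schmidt does not
    change the first vector, so \<open>v\<close> stays an eigenvector in first place.\<close>
  define ws where "ws = gram_schmidt (Suc n) (basis_completion v)"
  interpret cof_vec_space "Suc n" "TYPE(complex)" .
  note bc = basis_completion[OF v(1,2)]
  from gram_schmidt_result[OF bc(2,4) bc(5) refl, folded ws_def] bc
  have ws: "set ws \<subseteq> carrier_vec (Suc n)" "corthogonal ws" "length ws = Suc n" by auto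
  obtain vs where "basis_completion v = v # vs" using bc by (cases "basis_completion v") auto
  with gram_schmidt_hd[OF v(1), of vs] have hd: "ws ! 0 = v"
    using ws(3) hd_conv_nth[of ws] by (metis list.size(3) nat.distinct(1) ws_def)
  \<comment> \<open>Gram-Schmidt yields orthogonal vectors that are not normalised;
    \<open>N w\<close> is the factor that normalises \<open>w\<close>.\<close>
  define N where "N w = complex_of_real (1 / sqrt (Re (w \<bullet>c w)))" for w :: "complex vec"
  define W where "W = Matrix.mat (Suc n) (Suc n) (\<lambda>(i, j). N (ws ! j) * ws ! j $ i)"
  have W: "W \<in> carrier_mat (Suc n) (Suc n)" by (simp add: W_def)
  have wsc: "ws ! j \<in> carrier_vec (Suc n)" if "j < Suc n" for j using ws that by auto
  have "mat_adjoint W * W = 1\<^sub>m (Suc n)"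
  proof (rule eq_matI)
    fix i j assume "i < dim_row (1\<^sub>m (Suc n))" "j < dim_col (1\<^sub>m (Suc n))"
    then have ij: "i < Suc n" "j < Suc n" by auto
    have "(mat_adjoint W * W) $$ (i, j) = (\<Sum>k<Suc n. cnj (W $$ (k, i)) * W $$ (k, j))"
      using ij W
      by (simp add: scalar_prod_def lessThan_atLeast0)
    also have "\<dots> = cnj (N (ws ! i)) * N (ws ! j) * (\<Sum>k<Suc n. ws ! j $ k * cnj (ws ! i $ k))"
      unfolding sum_distrib_left using ij by (intro sum.cong) (auto simp: W_def)
    also have "(\<Sum>k<Suc n. ws ! j $ k * cnj (ws ! i $ k)) = ws ! j \<bullet>c ws ! i"
      using wsc[OF ij(1)] by (simp add: scalar_prod_def lessThan_atLeast0)
    also have "cnj (N (ws ! i)) * N (ws ! j) * (ws ! j \<bullet>c ws ! i) = 1\<^sub>m (Suc n) $$ (i, j)"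
    proof (cases "i = j")
      case True
      have "ws ! i \<bullet>c ws ! i > 0"
        using corthogonalD[OF ws(2), of i i] ij ws(3) wsc[OF ij(1)] conjugate_square_positive
        by (metis order_le_less conjugate_square_ge_0_vec)
      then have pos: "Re (ws ! i \<bullet>c ws ! i) > 0"
        and re: "ws ! i \<bullet>c ws ! i = complex_of_real (Re (ws ! i \<bullet>c ws ! i))"
        by (auto simp: less_complex_def complex_eq_iff)
      have "complex_of_real (1 / sqrt x) * complex_of_real (1 / sqrt x) * complex_of_real x = 1"
        if "x > 0" for x
        using that by (simp flip: of_real_mult)
      from this[OF pos] have "cnj (N (ws ! i)) * N (ws ! i) * (ws ! i \<bullet>c ws ! i) = 1"
        unfolding re[symmetric] N_def complex_cnj_complex_of_real .
      then show ?thesis using True ij by simp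
    next
      case False
      then have "ws ! j \<bullet>c ws ! i = 0" using corthogonalD[OF ws(2), of j i] ij ws(3) by auto
      then show ?thesis using False ij by simp
    qed
    finally show "(mat_adjoint W * W) $$ (i, j) = 1\<^sub>m (Suc n) $$ (i, j)" .
  qed (use W in auto)
  moreover have "Matrix.col W 0 = N v \<cdot>\<^sub>v v"
    using v(1) hd by (intro eq_vecI) (auto simp: W_def)
  moreover have "A *\<^sub>v (N v \<cdot>\<^sub>v v) = e \<cdot>\<^sub>v (N v \<cdot>\<^sub>v v)"
    unfolding mult_mat_vec[OF A v(1)] v(3) smult_smult_assoc by (simp only: mult.commute)
  ultimately show ?thesis
    using W unfolding unitary_mat_def by (intro exI[of _ W] exI[of _ e]) simp
qed

lemma mult_mat_unit_vec:
  "A \<in> carrier_mat n m \<Longrightarrow> i < m \<Longrightarrow> A *\<^sub>v unit_vec m i = Matrix.col (A :: complex mat) i"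
  by (rule eq_vecI) auto

text \<open>The first column is \<open>e\<close> times the first basis vector; Hermiticity carries
  this over to the first row and makes \<open>e\<close> real.\<close>

lemma hermitian_block_decomposition:
  assumes H: "(H :: complex mat) \<in> carrier_mat (Suc n) (Suc n)" and h: "mat_adjoint H = H"
    and e: "H *\<^sub>v unit_vec (Suc n) 0 = e \<cdot>\<^sub>v unit_vec (Suc n) 0"
  shows "\<exists>r N. N \<in> carrier_mat n n \<and> mat_adjoint N = N \<and>
    H = four_block_mat (real_diag 1 (\<lambda>_. r)) (0\<^sub>m 1 n) (0\<^sub>m n 1) N"
proof -
  have col: "H $$ (i, 0) = (if i = 0 then e else 0)" if "i < Suc n" for i
    using arg_cong[OF e, of "\<lambda>v. v $ i"] that H
    by (auto simp: mult_mat_unit_vec)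
  have sym: "H $$ (i, j) = cnj (H $$ (j, i))" if "i < Suc n" "j < Suc n" for i j
    using arg_cong[OF h, of "\<lambda>M. M $$ (i, j)"] that H by simp
  have row: "H $$ (0, i) = (if i = 0 then e else 0)" if "i < Suc n" for i
    using sym[of 0 i] sym[of 0 0] col[OF that] col[of 0] that by (auto split: if_splits)
  have "e = cnj e" using sym[of 0 0] col[of 0] by simp
  then have er: "complex_of_real (Re e) = e" by (auto simp: complex_eq_iff)
  define N where "N = Matrix.mat n n (\<lambda>(i, j). H $$ (Suc i, Suc j))"
  have "mat_adjoint N = N"
    by (rule eq_matI) (simp_all add: N_def sym[of "Suc _" "Suc _", symmetric])
  moreover have "H = four_block_mat (real_diag 1 (\<lambda>_. Re e)) (0\<^sub>m 1 n) (0\<^sub>m n 1) N"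
    (is "_ = ?F")
  proof (rule eq_matI)
    fix i j assume "i < dim_row ?F" "j < dim_col ?F"
    then have "i < Suc n" "j < Suc n" by (simp_all add: N_def real_diag_def)
    then show "H $$ (i, j) = ?F $$ (i, j)"
      using col[of i] row[of j] er by (cases i; cases j) (simp_all add: N_def real_diag_def)
  qed (use H in \<open>simp_all add: N_def real_diag_def\<close>)
  moreover have "N \<in> carrier_mat n n" by (simp add: N_def)
  ultimately show ?thesis by blast
qed

text \<open>Deflation: in an orthonormal basis that starts with an eigenvector a 1 by 1 block splits
  off. The change of basis is unitary, so the remaining block is again Hermitian and the induction
  hypothesis applies to it.\<close>

theorem hermitian_unitary_diagonalization:
  assumes "(A :: complex mat) \<in> carrier_mat n n" and "mat_adjoint A = A"
  shows "\<exists>U l. unitary_mat n U \<and> A = U * real_diag n l * mat_adjoint U"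
  using assms
proof (induction n arbitrary: A)
  case 0
  then show ?case
    by (intro exI[of _ "1\<^sub>m 0"] exI[of _ "\<lambda>_. 0"]) (auto simp: unitary_mat_def intro!: eq_matI)
next
  case (Suc n)
  note A = Suc.prems(1)
  obtain W e where W: "unitary_mat (Suc n) W" and ev: "A *\<^sub>v Matrix.col W 0 = e \<cdot>\<^sub>v Matrix.col W 0"
    using exists_unitary_with_eigenvector[OF A] by blast
  note WW = unitary_mat_right_inverse[OF W]
  have Wc: "W \<in> carrier_mat (Suc n) (Suc n)" "mat_adjoint W \<in> carrier_mat (Suc n) (Suc n)"
    and WW': "mat_adjoint W * W = 1\<^sub>m (Suc n)"
    using W by (auto simp: unitary_mat_def)
  define H where "H = mat_adjoint W * (A * W)"
  have H: "H \<in> carrier_mat (Suc n) (Suc n)"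
    unfolding H_def using A Wc by (intro mult_carrier_mat[of _ _ "Suc n"])
  have "mat_adjoint H = H"
    using A Wc Suc.prems(2) unfolding H_def
    by (simp add: square_mat_simps[of _ "Suc n"] del: mult_carrier_mat)
  moreover have "H *\<^sub>v unit_vec (Suc n) 0 = e \<cdot>\<^sub>v unit_vec (Suc n) 0"
  proof -
    have c0: "Matrix.col W 0 = W *\<^sub>v unit_vec (Suc n) 0" using Wc by (simp add: mult_mat_unit_vec)
    have "H *\<^sub>v unit_vec (Suc n) 0 = mat_adjoint W *\<^sub>v (A *\<^sub>v Matrix.col W 0)"
      using A Wc unfolding H_def c0 by (simp add: mult_carrier_square_mat assoc_mult_mat_vec[of _ "Suc n" "Suc n" _ "Suc n"] del: mult_carrier_mat)
    moreover have "mat_adjoint W *\<^sub>v (A *\<^sub>v Matrix.col W 0) = e \<cdot>\<^sub>v (mat_adjoint W *\<^sub>v Matrix.col W 0)"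
      unfolding ev by (rule mult_mat_vec[OF Wc(2) col_carrier_vec[OF _ Wc(1)]]) simp
    moreover have "mat_adjoint W *\<^sub>v Matrix.col W 0 = unit_vec (Suc n) 0"
      unfolding c0 assoc_mult_mat_vec[OF Wc(2,1) unit_vec_carrier, symmetric] WW'
      by (rule one_mult_mat_vec[OF unit_vec_carrier])
    ultimately show ?thesis by metis
  qed
  ultimately obtain r N where N: "N \<in> carrier_mat n n" "mat_adjoint N = N"
    and HN: "H = four_block_mat (real_diag 1 (\<lambda>_. r)) (0\<^sub>m 1 n) (0\<^sub>m n 1) N"
    using hermitian_block_decomposition[OF H] by blast
  obtain U l where U: "unitary_mat n U" and NU: "N = U * real_diag n l * mat_adjoint U"
    using Suc.IH[OF N] by blast
  have Uc: "U \<in> carrier_mat n n" "mat_adjoint U \<in> carrier_mat n n" "mat_adjoint U * U = 1\<^sub>m n"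
    using U by (auto simp: unitary_mat_def)
  define V where "V = four_block_mat (1\<^sub>m 1) (0\<^sub>m 1 n) (0\<^sub>m n 1) U"
  define m where "m i = (case i of 0 \<Rightarrow> r | Suc j \<Rightarrow> l j)" for i
  have V': "mat_adjoint V = four_block_mat (1\<^sub>m 1) (0\<^sub>m 1 n) (0\<^sub>m n 1) (mat_adjoint U)"
  proof -
    have "mat_adjoint (1\<^sub>m 1) = (1\<^sub>m 1 :: complex mat)" "mat_adjoint (0\<^sub>m 1 n) = (0\<^sub>m n 1 :: complex mat)"
      "mat_adjoint (0\<^sub>m n 1) = (0\<^sub>m 1 n :: complex mat)"
      by (auto intro!: eq_matI)
    then show ?thesis
      unfolding V_def by (subst mat_adjoint_four_block[of _ 1 1 _ n _ n]) (use Uc in auto)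
  qed
  have Vc: "V \<in> carrier_mat (Suc n) (Suc n)" "mat_adjoint V \<in> carrier_mat (Suc n) (Suc n)"
    using Uc by (auto simp: V_def)
  have "mat_adjoint V * V = four_block_mat (1\<^sub>m 1) (0\<^sub>m 1 n) (0\<^sub>m n 1) (1\<^sub>m n)"
    unfolding V' unfolding V_def using Uc
    by (simp only: mult_block_diag[of _ 1 _ _ n] one_carrier_mat left_mult_one_mat[of _ 1 1])
  also have "\<dots> = 1\<^sub>m (Suc n)" by (rule eq_matI) auto
  finally have "mat_adjoint V * V = 1\<^sub>m (Suc n)" .
  with Vc have V: "unitary_mat (Suc n) V" by (simp add: unitary_mat_def)
  have D: "real_diag (Suc n) m = four_block_mat (real_diag 1 (\<lambda>_. r)) (0\<^sub>m 1 n) (0\<^sub>m n 1) (real_diag n l)"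
    by (rule eq_matI) (auto simp: real_diag_def m_def split: nat.splits)
  have VH: "V * real_diag (Suc n) m * mat_adjoint V = H"
    unfolding D V' HN NU unfolding V_def using Uc(1,2)
    by (simp only: mult_block_diag[of _ 1 _ _ n] mult_carrier_square_mat[of _ n] one_carrier_mat
        real_diag_carrier left_mult_one_mat[of _ 1 1] right_mult_one_mat[of _ 1 1])
  have WA: "W * H * mat_adjoint W = A"
  proof -
    have "W * H * mat_adjoint W = (W * mat_adjoint W) * A * (W * mat_adjoint W)"
      using A Wc unfolding H_def by (simp add: square_mat_simps[of _ "Suc n"] del: mult_carrier_mat)
    then show ?thesis using A by (simp add: WW del: mult_carrier_mat)
  qed
  have "W * V * real_diag (Suc n) m * mat_adjoint (W * V) =
      W * (V * real_diag (Suc n) m * mat_adjoint V) * mat_adjoint W"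
    using Wc Vc by (simp add: square_mat_simps[of _ "Suc n"] del: mult_carrier_mat)
  also have "\<dots> = A" unfolding VH WA ..
  finally have "A = W * V * real_diag (Suc n) m * mat_adjoint (W * V)" ..
  then show ?case using unitary_mat_mult[OF W V] by blast
qed

lemma proots_prod_list_linear: "proots (\<Prod>a\<leftarrow>as. [:- a, 1:]) = mset (as :: 'a :: idom list)"
proof (induction as)
  case (Cons a as)
  have "(\<Prod>a\<leftarrow>as. [:- a, 1:]) \<noteq> 0" by (auto simp: prod_list_zero_iff)
  then have "proots ([:- a, 1:] * (\<Prod>a\<leftarrow>as. [:- a, 1:])) =
      proots [:- a, 1:] + proots (\<Prod>a\<leftarrow>as. [:- a, 1:])"
    by (intro proots_mult) simp_all
  then show ?case
    unfolding Cons.IH proots_linear_factor list.map prod_list.Cons by simp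
qed simp

text \<open>Similarity preserves the characteristic polynomial, and that of a diagonal matrix is a
  product of linear factors; its multiset of roots is therefore the list of diagonal
  entries.\<close>

lemma vn_entropy_unitary_diagonalization:
  assumes "unitary_mat n U" and "A = U * real_diag n l * mat_adjoint U"
  shows "vn_entropy A = - (\<Sum>k<n. l k * log 2 (l k))"
proof -
  have c: "U \<in> carrier_mat n n" "mat_adjoint U \<in> carrier_mat n n" "mat_adjoint U * U = 1\<^sub>m n"
    using assms(1) by (auto simp: unitary_mat_def)
  have "similar_mat A (real_diag n l)"
    using c unitary_mat_right_inverse[OF assms(1)] unfolding similar_mat_def assms(2)
    by (intro exI[of _ U] exI[of _ "mat_adjoint U"] similar_mat_witI[of _ _ n] refl)
      (simp_all add: mult_carrier_square_mat del: mult_carrier_mat)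
  moreover have "upper_triangular (real_diag n l)" by (auto simp: real_diag_def)
  ultimately have "char_poly A = (\<Prod>a\<leftarrow>diag_mat (real_diag n l). [:- a, 1:])"
    by (simp only: char_poly_similar char_poly_upper_triangular[OF real_diag_carrier])
  moreover have "diag_mat (real_diag n l) = map (\<lambda>k. complex_of_real (l k)) [0..<n]"
    by (simp add: diag_mat_def real_diag_def)
  ultimately have "proots (char_poly A) = mset (map (\<lambda>k. complex_of_real (l k)) [0..<n])"
    using proots_prod_list_linear by metis
  then have "vn_entropy A = - sum_mset (image_mset (\<lambda>k. l k * log 2 (l k)) (mset [0..<n]))"
    unfolding vn_entropy_def mset_map by (simp only: image_mset.compositionality o_def complex.sel Re_complex_of_real)
  then show ?thesis
    by (simp only: sum_unfold_sum_mset mset_upt lessThan_atLeast0)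
qed


section \<open>Entropy inequalities\<close>

text \<open>The spectral decomposition in terms of functions on indices: \<open>u k\<close> is the
  eigenvector for the real eigenvalue \<open>l k\<close>. In this form the eigenvectors of a
  composite system can be assembled by index arithmetic.\<close>

definition eigenbasis :: "nat \<Rightarrow> complex mat \<Rightarrow> (nat \<Rightarrow> nat \<Rightarrow> complex) \<Rightarrow> (nat \<Rightarrow> real) \<Rightarrow> bool" where
  "eigenbasis n A u l \<longleftrightarrow> A \<in> carrier_mat n n \<and>
     (\<forall>j<n. \<forall>k<n. (\<Sum>a<n. cnj (u j a) * u k a) = of_bool (j = k)) \<and>
     (\<forall>a<n. \<forall>b<n. A $$ (a, b) = (\<Sum>k<n. of_real (l k) * (u k a * cnj (u k b))))"

lemma index_mult_mat_sum:
  assumes "A \<in> carrier_mat n m" and "B \<in> carrier_mat m k" and "i < n" and "j < k"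
  shows "(A * B) $$ (i, j) = (\<Sum>l<m. A $$ (i, l) * B $$ (l, j))"
  using assms by (simp add: scalar_prod_def lessThan_atLeast0)

lemma eigenbasis_unitary:
  assumes "eigenbasis n A u l"
  defines "U \<equiv> Matrix.mat n n (\<lambda>(a, k). u k a)"
  shows "unitary_mat n U" and "A = U * real_diag n l * mat_adjoint U"
proof -
  have U: "U \<in> carrier_mat n n" by (simp add: U_def)
  have "mat_adjoint U * U = 1\<^sub>m n"
    by (rule eq_matI)
      (use assms in \<open>auto simp: eigenbasis_def U_def scalar_prod_def lessThan_atLeast0\<close>)
  with U show "unitary_mat n U" by (simp add: unitary_mat_def)
  have D: "(U * real_diag n l) $$ (a, k) = of_real (l k) * u k a" if "a < n" "k < n" for a k
  proof -
    have "(U * real_diag n l) $$ (a, k) = (\<Sum>j<n. u j a * (if j = k then of_real (l j) else 0))"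
      using that by (simp add: U_def real_diag_def scalar_prod_def lessThan_atLeast0)
    also have "\<dots> = (\<Sum>j<n. if j = k then of_real (l k) * u k a else 0)"
      by (intro sum.cong) auto
    finally show ?thesis using that by simp
  qed
  show "A = U * real_diag n l * mat_adjoint U"
  proof (rule eq_matI)
    fix a b assume "a < dim_row (U * real_diag n l * mat_adjoint U)" "b < dim_col (U * real_diag n l * mat_adjoint U)"
    then have ab: "a < n" "b < n" by (simp_all add: U_def)
    have "(U * real_diag n l * mat_adjoint U) $$ (a, b) =
        (\<Sum>k<n. (U * real_diag n l) $$ (a, k) * mat_adjoint U $$ (k, b))"
      by (rule index_mult_mat_sum) (use ab U in \<open>auto intro: mult_carrier_square_mat\<close>)
    also have "\<dots> = (\<Sum>k<n. of_real (l k) * (u k a * cnj (u k b)))"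
      using ab D by (intro sum.cong) (simp_all add: U_def del: index_mult_mat(1))
    finally show "A $$ (a, b) = (U * real_diag n l * mat_adjoint U) $$ (a, b)"
      using assms(1) ab by (simp add: eigenbasis_def)
  qed (use assms in \<open>auto simp: eigenbasis_def U_def\<close>)
qed

lemma vn_entropy_eigenbasis:
  "eigenbasis n A u l \<Longrightarrow> vn_entropy A = - (\<Sum>k<n. l k * log 2 (l k))"
  using vn_entropy_unitary_diagonalization eigenbasis_unitary by metis

text \<open>The matrix with columns \<open>u k\<close> is square, so its left inverse is a right
  inverse: orthonormality implies the resolution of the identity.\<close>

lemma eigenbasis_complete:
  assumes "eigenbasis n A u l" and "a < n" and "b < n"
  shows "(\<Sum>k<n. u k a * cnj (u k b)) = of_bool (a = b)"
proof -
  define U where "U = Matrix.mat n n (\<lambda>(a, k). u k a)"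
  have "(U * mat_adjoint U) $$ (a, b) = 1\<^sub>m n $$ (a, b)"
    using unitary_mat_right_inverse[OF eigenbasis_unitary(1)[OF assms(1)]] by (simp add: U_def)
  moreover have "(U * mat_adjoint U) $$ (a, b) = (\<Sum>k<n. u k a * cnj (u k b))"
    using assms by (simp add: U_def scalar_prod_def lessThan_atLeast0)
  ultimately show ?thesis using assms by simp
qed

lemma hermitian_eigenbasis:
  assumes A: "A \<in> carrier_mat n n" and h: "mat_adjoint A = A"
  shows "\<exists>u l. eigenbasis n A u l"
proof -
  obtain U l where U: "unitary_mat n U" and AU: "A = U * real_diag n l * mat_adjoint U"
    using hermitian_unitary_diagonalization[OF A h] by blast
  have Uc: "U \<in> carrier_mat n n" using U by (simp add: unitary_mat_def)
  have "(\<Sum>a<n. cnj (U $$ (a, j)) * U $$ (a, k)) = of_bool (j = k)" if "j < n" "k < n" for j k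
  proof -
    have "(mat_adjoint U * U) $$ (j, k) = (\<Sum>a<n. cnj (U $$ (a, j)) * U $$ (a, k))"
      using that Uc by (simp add: scalar_prod_def lessThan_atLeast0)
    moreover have "(mat_adjoint U * U) $$ (j, k) = of_bool (j = k)"
      using U that by (simp add: unitary_mat_def del: index_mult_mat(1))
    ultimately show ?thesis by simp
  qed
  moreover have "A $$ (a, b) = (\<Sum>k<n. of_real (l k) * (U $$ (a, k) * cnj (U $$ (b, k))))"
    if ab: "a < n" "b < n" for a b
  proof -
    have D: "(U * real_diag n l) $$ (a, k) = of_real (l k) * U $$ (a, k)" if "k < n" for k
    proof -
      have "(U * real_diag n l) $$ (a, k) = (\<Sum>j<n. U $$ (a, j) * (if j = k then of_real (l j) else 0))"
        using that ab Uc by (simp add: real_diag_def scalar_prod_def lessThan_atLeast0)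
      also have "\<dots> = (\<Sum>j<n. if j = k then of_real (l k) * U $$ (a, k) else 0)"
        by (intro sum.cong) auto
      finally show ?thesis using that by simp
    qed
    have "A $$ (a, b) = (\<Sum>k<n. (U * real_diag n l) $$ (a, k) * mat_adjoint U $$ (k, b))"
      unfolding AU by (rule index_mult_mat_sum) (use ab Uc in \<open>auto intro: mult_carrier_square_mat\<close>)
    also have "\<dots> = (\<Sum>k<n. of_real (l k) * (U $$ (a, k) * cnj (U $$ (b, k))))"
      using ab Uc D by (intro sum.cong) (simp_all del: index_mult_mat(1))
    finally show ?thesis .
  qed
  ultimately show ?thesis
    using A by (intro exI[of _ "\<lambda>k a. U $$ (a, k)"] exI[of _ l]) (simp add: eigenbasis_def)
qed

section \<open>Quadratic forms and traces in an eigenbasis\<close>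

definition quad_form :: "nat \<Rightarrow> complex mat \<Rightarrow> (nat \<Rightarrow> complex) \<Rightarrow> complex" where
  "quad_form n A x = (\<Sum>a<n. \<Sum>b<n. cnj (x a) * A $$ (a, b) * x b)"

lemma quad_form_eigenbasis:
  assumes "eigenbasis n A u l"
  shows "quad_form n A x = of_real (\<Sum>k<n. l k * (cmod (\<Sum>a<n. cnj (u k a) * x a))\<^sup>2)"
proof -
  have "quad_form n A x = (\<Sum>a<n. \<Sum>b<n. \<Sum>k<n. of_real (l k) * ((cnj (x a) * u k a) * (cnj (u k b) * x b)))"
    unfolding quad_form_def using assms
    by (intro sum.cong refl) (simp add: eigenbasis_def sum_distrib_left sum_distrib_right mult_ac)
  also have "\<dots> = (\<Sum>a<n. \<Sum>k<n. \<Sum>b<n. of_real (l k) * ((cnj (x a) * u k a) * (cnj (u k b) * x b)))"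
    by (intro sum.cong refl sum.swap)
  also have "\<dots> = (\<Sum>k<n. \<Sum>a<n. \<Sum>b<n. of_real (l k) * ((cnj (x a) * u k a) * (cnj (u k b) * x b)))"
    by (rule sum.swap)
  also have "\<dots> = (\<Sum>k<n. of_real (l k) * (cnj (\<Sum>a<n. cnj (u k a) * x a) * (\<Sum>a<n. cnj (u k a) * x a)))"
    by (intro sum.cong refl) (simp add: sum_product sum_distrib_left mult_ac)
  also have "\<dots> = (\<Sum>k<n. of_real (l k) * of_real ((cmod (\<Sum>a<n. cnj (u k a) * x a))\<^sup>2))"
    by (simp only: complex_norm_square mult.commute)
  finally show ?thesis by simp
qed

lemma quad_form_eigenvector:
  assumes "eigenbasis n A u l" and "k < n"
  shows "quad_form n A (u k) = of_real (l k)"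
proof -
  have "(\<Sum>j<n. l j * (cmod (\<Sum>a<n. cnj (u j a) * u k a))\<^sup>2) = (\<Sum>j<n. if j = k then l k else 0)"
    using assms by (intro sum.cong) (auto simp: eigenbasis_def)
  then show ?thesis using assms(2) unfolding quad_form_eigenbasis[OF assms(1)] by simp
qed

lemma sum_eigenvalues:
  assumes "eigenbasis n A u l"
  shows "(\<Sum>a<n. A $$ (a, a)) = of_real (\<Sum>k<n. l k)"
proof -
  have "(\<Sum>a<n. A $$ (a, a)) = (\<Sum>k<n. \<Sum>a<n. of_real (l k) * (u k a * cnj (u k a)))"
    using assms by (subst sum.swap) (simp add: eigenbasis_def)
  also have "\<dots> = (\<Sum>k<n. of_real (l k) * (\<Sum>a<n. cnj (u k a) * u k a))"
    by (simp add: sum_distrib_left mult.commute)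
  also have "\<dots> = (\<Sum>k<n. of_real (l k))"
    using assms by (intro sum.cong refl) (simp add: eigenbasis_def)
  finally show ?thesis by simp
qed

text \<open>The trace of \<open>B\<close> may be computed in any orthonormal basis; \<open>A\<close>
  supplies one, which need not diagonalise \<open>B\<close>.\<close>

lemma sum_quad_form_eigenbasis:
  assumes "eigenbasis n A u l" and "B \<in> carrier_mat n n"
  shows "(\<Sum>k<n. quad_form n B (u k)) = (\<Sum>a<n. B $$ (a, a))"
proof -
  have "(\<Sum>k<n. quad_form n B (u k)) = (\<Sum>a<n. \<Sum>b<n. \<Sum>k<n. cnj (u k a) * B $$ (a, b) * u k b)"
    unfolding quad_form_def
    by (subst sum.swap, rule sum.cong[OF refl], subst sum.swap, rule refl)
  also have "\<dots> = (\<Sum>a<n. \<Sum>b<n. B $$ (a, b) * (\<Sum>k<n. u k b * cnj (u k a)))"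
    by (simp add: sum_distrib_left mult_ac)
  also have "\<dots> = (\<Sum>a<n. \<Sum>b<n. if a = b then B $$ (a, a) else 0)"
    using eigenbasis_complete[OF assms(1)] by (intro sum.cong refl) auto
  finally show ?thesis by simp
qed

section \<open>Gibbs' inequality\<close>

definition density_mat :: "nat \<Rightarrow> complex mat \<Rightarrow> bool" where
  "density_mat n A \<longleftrightarrow> A \<in> carrier_mat n n \<and> mat_adjoint A = A \<and> (\<forall>x. 0 \<le> quad_form n A x) \<and>
     (\<Sum>a<n. A $$ (a, a)) = 1"

lemma eigenvalue_nonneg:
  assumes "eigenbasis n A u l" and "\<And>x. 0 \<le> quad_form n A x" and "k < n"
  shows "0 \<le> l k"
  using assms(2)[of "u k"] quad_form_eigenvector[OF assms(1,3)] by (simp add: less_eq_complex_def)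

text \<open>This is \<open>ln x \<le> x - 1\<close> at \<open>x = q / p\<close>, multiplied by
  \<open>p\<close> and the weight \<open>D\<close>. For \<open>q = 0\<close> the logarithm has a
  default value instead of minus infinity, hence the condition that such terms carry no
  weight.\<close>

lemma log_le_gibbs:
  assumes "0 \<le> p" and "0 \<le> q" and "0 \<le> D" and "q = 0 \<Longrightarrow> p * D = 0"
  shows "D * (p - q) / ln 2 \<le> D * p * (log 2 p - log 2 q)"
proof (cases "p = 0 \<or> q = 0 \<or> D = 0")
  case True
  then show ?thesis using assms by (auto simp: divide_nonpos_pos)
next
  case False
  then have pos: "p > 0" "q > 0" using assms by auto
  have "ln (q / p) \<le> q / p - 1" using pos by (intro ln_le_minus_one) simp
  then have "p * (ln q - ln p) \<le> p * (q / p - 1)"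
    using pos by (simp add: ln_div)
  also have "\<dots> = q - p" using pos by (simp add: right_diff_distrib)
  finally have "p - q \<le> p * (ln p - ln q)" by (simp add: algebra_simps)
  then have "D * (p - q) / ln 2 \<le> D * (p * (ln p - ln q)) / ln 2"
    using assms by (intro divide_right_mono mult_left_mono) auto
  then show ?thesis by (simp add: log_def mult.assoc flip: diff_divide_distrib)
qed

text \<open>Nonnegativity of the relative entropy of \<open>M\<close> with respect to the operator
  with eigenvectors \<open>f j\<close> and weights \<open>q j\<close>. The orthonormal basis
  \<open>f\<close> comes from \<open>B\<close>, whereas the weights are chosen freely; each
  application picks both to suit its inequality. The support condition replaces the value infinity
  of the relative entropy.\<close>

lemma gibbs_entropy_bound:
  assumes M: "density_mat n M" and f: "eigenbasis n B f b"
    and q: "\<And>j. j < n \<Longrightarrow> 0 \<le> q j" "(\<Sum>j<n. q j) \<le> 1"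
    and supp: "\<And>j. j < n \<Longrightarrow> q j = 0 \<Longrightarrow> quad_form n M (f j) = 0"
  shows "vn_entropy M \<le> - (\<Sum>j<n. Re (quad_form n M (f j)) * log 2 (q j))"
proof -
  have Mc: "M \<in> carrier_mat n n" "mat_adjoint M = M" "\<And>x. 0 \<le> quad_form n M x"
    and tr: "(\<Sum>a<n. M $$ (a, a)) = 1"
    using M by (auto simp: density_mat_def)
  obtain u p where up: "eigenbasis n M u p" using hermitian_eigenbasis[OF Mc(1,2)] by blast
  have p: "0 \<le> p k" if "k < n" for k using eigenvalue_nonneg[OF up Mc(3) that] .
  have sp: "(\<Sum>k<n. p k) = 1"
    using sum_eigenvalues[OF up] tr by (metis of_real_eq_1_iff)
  \<comment> \<open>The squared overlaps of the two bases form a doubly stochastic matrix: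
    completeness of \<open>f\<close> gives the sums over \<open>j\<close>, completeness of
    \<open>u\<close> those over \<open>k\<close>.\<close>
  define D where "D k j = (cmod (\<Sum>a<n. cnj (u k a) * f j a))\<^sup>2" for k j
  have D0: "0 \<le> D k j" for k j by (simp add: D_def)
  have m: "Re (quad_form n M (f j)) = (\<Sum>k<n. p k * D k j)" for j
    by (simp add: quad_form_eigenbasis[OF up] D_def)
  have Dc: "complex_of_real (D k j) = (\<Sum>a<n. \<Sum>b<n. (cnj (u k a) * u k b) * (f j a * cnj (f j b)))" for k j
    unfolding D_def complex_norm_square by (simp add: sum_product mult_ac)
  have Dj: "(\<Sum>j<n. D k j) = 1" if k: "k < n" for k
  proof -
    have "complex_of_real (\<Sum>j<n. D k j) =
        (\<Sum>a<n. \<Sum>b<n. (cnj (u k a) * u k b) * (\<Sum>j<n. f j a * cnj (f j b)))"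
      unfolding of_real_sum Dc sum_distrib_left
      by (subst sum.swap, rule sum.cong[OF refl], subst sum.swap, rule refl)
    also have "\<dots> = (\<Sum>a<n. \<Sum>b<n. if a = b then cnj (u k a) * u k a else 0)"
      using eigenbasis_complete[OF f] by (intro sum.cong refl) auto
    also have "\<dots> = 1" using up k by (simp add: eigenbasis_def)
    finally show ?thesis by (metis of_real_eq_1_iff)
  qed
  have Dk: "(\<Sum>k<n. D k j) = 1" if j: "j < n" for j
  proof -
    have "complex_of_real (\<Sum>k<n. D k j) =
        (\<Sum>a<n. \<Sum>b<n. (f j a * cnj (f j b)) * (\<Sum>k<n. u k b * cnj (u k a)))"
      unfolding of_real_sum Dc sum_distrib_left
      by (subst sum.swap, rule sum.cong[OF refl], subst sum.swap) (simp add: mult_ac)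
    also have "\<dots> = (\<Sum>a<n. \<Sum>b<n. if a = b then cnj (f j a) * f j a else 0)"
      using eigenbasis_complete[OF up] by (intro sum.cong refl) auto
    also have "\<dots> = 1" using f j by (simp add: eigenbasis_def)
    finally show ?thesis by (metis of_real_eq_1_iff)
  qed
  have zero: "p k * D k j = 0" if "k < n" "j < n" "q j = 0" for k j
  proof -
    have "(\<Sum>k<n. p k * D k j) = 0" using supp[OF that(2,3)] m[of j] by simp
    then show ?thesis using that p D0 by (subst (asm) sum_nonneg_eq_0_iff) auto
  qed
  \<comment> \<open>The difference of the total weights is rewritten, by double stochasticity, as a
    double sum weighted with \<open>D k j\<close>; the scalar inequality then applies to each
    term.\<close>
  have "0 \<le> ((\<Sum>k<n. p k) - (\<Sum>j<n. q j)) / ln 2" using q sp by simp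
  also have "(\<Sum>k<n. p k) - (\<Sum>j<n. q j) = (\<Sum>k<n. \<Sum>j<n. D k j * p k) - (\<Sum>k<n. \<Sum>j<n. D k j * q j)"
  proof -
    have "(\<Sum>k<n. \<Sum>j<n. D k j * q j) = (\<Sum>j<n. q j)"
      by (subst sum.swap) (simp add: Dk flip: sum_distrib_right)
    then show ?thesis by (simp add: Dj flip: sum_distrib_right)
  qed
  also have "\<dots> / ln 2 = (\<Sum>k<n. \<Sum>j<n. D k j * (p k - q j) / ln 2)"
    by (simp add: sum_divide_distrib sum_subtractf right_diff_distrib diff_divide_distrib)
  also have "\<dots> \<le> (\<Sum>k<n. \<Sum>j<n. D k j * p k * (log 2 (p k) - log 2 (q j)))"
    using p q D0 zero by (intro sum_mono log_le_gibbs) auto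
  also have "\<dots> = (\<Sum>k<n. \<Sum>j<n. D k j * (p k * log 2 (p k))) - (\<Sum>k<n. \<Sum>j<n. p k * D k j * log 2 (q j))"
    by (simp add: sum_subtractf algebra_simps)
  also have "(\<Sum>k<n. \<Sum>j<n. D k j * (p k * log 2 (p k))) = (\<Sum>k<n. p k * log 2 (p k))"
    by (simp add: Dj flip: sum_distrib_right)
  also have "(\<Sum>k<n. \<Sum>j<n. p k * D k j * log 2 (q j)) = (\<Sum>j<n. Re (quad_form n M (f j)) * log 2 (q j))"
    unfolding m by (subst sum.swap) (simp add: sum_distrib_right)
  finally show ?thesis unfolding vn_entropy_eigenbasis[OF up] by simp
qed

section \<open>Block structure with respect to the target\<close>

lemma sum_lessThan_double: "(\<Sum>i<2 * m. F i) = (\<Sum>r<m. F (2 * r) + F (1 + 2 * (r :: nat)) :: 'a :: comm_monoid_add)"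
  by (induction m) (simp_all add: add.assoc)

lemma sum_lessThan_double': "(\<Sum>i<2 * m. F i) = (\<Sum>t<2. \<Sum>r<m. F (t + 2 * (r :: nat)) :: 'a :: comm_monoid_add)"
  unfolding sum_lessThan_double by (simp add: sum.distrib lessThan_Suc numeral_2_eq_2 add.commute mult_2)

text \<open>The target is the qubit \<open>0\<close>, hence the least significant bit: \<open>t + 2 * r\<close> is the index of the
  basis vector with target value \<open>t\<close> and index \<open>r\<close> on the remaining qubits.\<close>

definition target_block :: "nat \<Rightarrow> complex mat \<Rightarrow> nat \<Rightarrow> nat \<Rightarrow> complex mat" where
  "target_block m M t t' = Matrix.mat m m (\<lambda>(r, r'). M $$ (t + 2 * r, t' + 2 * r'))"

text \<open>The product of the target basis vector \<open>t\<close> with the vector \<open>g\<close>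
  of the remaining qubits.\<close>

definition target_extend :: "nat \<Rightarrow> (nat \<Rightarrow> complex) \<Rightarrow> nat \<Rightarrow> complex" where
  "target_extend t g = (\<lambda>a. if a mod 2 = t then g (a div 2) else 0)"

lemma target_block_carrier [simp]: "target_block m M t t' \<in> carrier_mat m m"
  by (simp add: target_block_def)

lemma dim_target_block [simp]:
  "dim_row (target_block m M t t') = m" "dim_col (target_block m M t t') = m"
  by (simp_all add: target_block_def)

lemma target_block_entry [simp]:
  "r < m \<Longrightarrow> r' < m \<Longrightarrow> target_block m M t t' $$ (r, r') = M $$ (t + 2 * r, t' + 2 * r')"
  by (simp add: target_block_def)

lemma sum_target_extend:
  assumes "t < 2"
  shows "(\<Sum>a<2 * m. F a * target_extend t g a) = (\<Sum>r<m. F (t + 2 * r) * g r :: complex)"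
  using assms unfolding sum_lessThan_double target_extend_def by (auto simp: less_2_cases_iff)

lemma sum_cnj_target_extend:
  assumes "t < 2"
  shows "(\<Sum>a<2 * m. cnj (target_extend t g a) * F a) = (\<Sum>r<m. cnj (g r) * F (t + 2 * r) :: complex)"
  using assms unfolding sum_lessThan_double target_extend_def by (auto simp: less_2_cases_iff)

lemma quad_form_target_extend:
  assumes "t < 2"
  shows "quad_form (2 * m) M (target_extend t g) = quad_form m (target_block m M t t) g"
proof -
  have "quad_form (2 * m) M (target_extend t g) =
      (\<Sum>a<2 * m. cnj (target_extend t g a) * (\<Sum>b<2 * m. M $$ (a, b) * target_extend t g b))"
    by (simp add: quad_form_def sum_distrib_left mult.assoc)
  then show ?thesis
    unfolding sum_target_extend[OF assms] sum_cnj_target_extend[OF assms]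
    by (simp add: quad_form_def sum_distrib_left mult.assoc)
qed

text \<open>Eigenvectors of the two diagonal blocks, extended by zero, form an eigenbasis of the
  whole. They are numbered like the basis vectors: \<open>i mod 2\<close> selects the block and
  \<open>i div 2\<close> the eigenvector in it.\<close>

lemma eigenbasis_block_diag:
  assumes M: "M \<in> carrier_mat (2 * m) (2 * m)"
    and off: "\<And>a b. a < 2 * m \<Longrightarrow> b < 2 * m \<Longrightarrow> a mod 2 \<noteq> b mod 2 \<Longrightarrow> M $$ (a, b) = 0"
    and u: "\<And>t. t < 2 \<Longrightarrow> eigenbasis m (target_block m M t t) (u t) (l t)"
  shows "eigenbasis (2 * m) M (\<lambda>i. target_extend (i mod 2) (u (i mod 2) (i div 2))) (\<lambda>i. l (i mod 2) (i div 2))"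
proof -
  have "(\<Sum>a<2 * m. cnj (target_extend (j mod 2) (u (j mod 2) (j div 2)) a) *
      target_extend (k mod 2) (u (k mod 2) (k div 2)) a) = of_bool (j = k)" (is "?s = _")
    if jk: "j < 2 * m" "k < 2 * m" for j k
  proof -
    have s: "?s = (\<Sum>r<m. cnj (u (j mod 2) (j div 2) r) * target_extend (k mod 2) (u (k mod 2) (k div 2)) (j mod 2 + 2 * r))"
      by (rule sum_cnj_target_extend) simp
    show ?thesis
    proof (cases "j mod 2 = k mod 2")
      case True
      then have "j div 2 = k div 2 \<longleftrightarrow> j = k" by (metis div_mult_mod_eq)
      moreover have "?s = (\<Sum>r<m. cnj (u (j mod 2) (j div 2) r) * u (j mod 2) (k div 2) r)"
        unfolding s using True by (simp add: target_extend_def)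
      moreover have "j div 2 < m" "k div 2 < m" using jk by auto
      ultimately show ?thesis using u[of "j mod 2"] by (simp add: eigenbasis_def)
    next
      case False
      then show ?thesis unfolding s by (auto simp: target_extend_def)
    qed
  qed
  moreover have "M $$ (a, b) = (\<Sum>i<2 * m. of_real (l (i mod 2) (i div 2)) *
      (target_extend (i mod 2) (u (i mod 2) (i div 2)) a * cnj (target_extend (i mod 2) (u (i mod 2) (i div 2)) b)))"
    (is "_ = ?s") if ab: "a < 2 * m" "b < 2 * m" for a b
  proof -
    have "?s = (\<Sum>t<2. \<Sum>r<m. of_real (l t r) * (target_extend t (u t r) a * cnj (target_extend t (u t r) b)))"
      unfolding sum_lessThan_double' by (intro sum.cong refl) auto
    also have "\<dots> = (\<Sum>t<2. if t = a mod 2 then if a mod 2 = b mod 2 then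
        (\<Sum>r<m. of_real (l t r) * (u t r (a div 2) * cnj (u t r (b div 2)))) else 0 else 0)"
      by (intro sum.cong refl) (auto simp: target_extend_def)
    also have "\<dots> = (if a mod 2 = b mod 2 then
        (\<Sum>r<m. of_real (l (a mod 2) r) * (u (a mod 2) r (a div 2) * cnj (u (a mod 2) r (b div 2)))) else 0)"
      by simp
    also have "\<dots> = M $$ (a, b)"
    proof (cases "a mod 2 = b mod 2")
      case True
      have ab2: "a div 2 < m" "b div 2 < m" using ab by auto
      then have "(\<Sum>r<m. of_real (l (a mod 2) r) * (u (a mod 2) r (a div 2) * cnj (u (a mod 2) r (b div 2)))) =
          target_block m M (a mod 2) (a mod 2) $$ (a div 2, b div 2)"
        using u[of "a mod 2"] by (simp add: eigenbasis_def del: target_block_entry)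
      also have "\<dots> = M $$ (a mod 2 + 2 * (a div 2), b mod 2 + 2 * (b div 2))"
        using ab2 True by simp
      also have "\<dots> = M $$ (a, b)" by (simp only: mod_mult_div_eq)
      finally show ?thesis using True by simp
    next
      case False
      then show ?thesis using off[OF ab] by simp
    qed
    finally show ?thesis ..
  qed
  ultimately show ?thesis using M unfolding eigenbasis_def by blast
qed

lemma hermitian_target_block:
  assumes "M \<in> carrier_mat (2 * m) (2 * m)" and "mat_adjoint M = M" and "t < 2"
  shows "mat_adjoint (target_block m M t t) = target_block m M t t"
proof (rule eq_matI)
  fix r r' assume "r < dim_row (target_block m M t t)" "r' < dim_col (target_block m M t t)"
  then have "r < m" "r' < m" "t + 2 * r < 2 * m" "t + 2 * r' < 2 * m"
    using assms(3) by (auto simp: target_block_def)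
  then show "mat_adjoint (target_block m M t t) $$ (r, r') = target_block m M t t $$ (r, r')"
    using assms(1) arg_cong[OF assms(2), of "\<lambda>M. M $$ (t + 2 * r, t + 2 * r')"]
    by (simp add: target_block_def)
qed (simp_all add: target_block_def)

lemma quad_form_target_block_nonneg:
  assumes "density_mat (2 * m) M" and "t < 2"
  shows "0 \<le> quad_form m (target_block m M t t) x"
  using assms(1) unfolding quad_form_target_extend[OF assms(2), symmetric] by (simp add: density_mat_def)

section \<open>Pinching and subadditivity\<close>

definition pinch :: "complex mat \<Rightarrow> complex mat" where
  "pinch M = Matrix.mat (dim_row M) (dim_col M) (\<lambda>(a, b). if a mod 2 = b mod 2 then M $$ (a, b) else 0)"

lemma target_block_pinch:
  "M \<in> carrier_mat (2 * m) (2 * m) \<Longrightarrow> t < 2 \<Longrightarrow> target_block m (pinch M) t t = target_block m M t t"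
  by (rule eq_matI) (auto simp: target_block_def pinch_def)

lemma pinch_eigenbasis:
  assumes "density_mat (2 * m) M"
  obtains u l where "\<And>t. t < 2 \<Longrightarrow> eigenbasis m (target_block m M t t) (u t) (l t)"
    and "eigenbasis (2 * m) (pinch M) (\<lambda>i. target_extend (i mod 2) (u (i mod 2) (i div 2))) (\<lambda>i. l (i mod 2) (i div 2))"
proof -
  have M: "M \<in> carrier_mat (2 * m) (2 * m)" "mat_adjoint M = M" using assms by (auto simp: density_mat_def)
  have "\<forall>t. \<exists>ul. t < 2 \<longrightarrow> eigenbasis m (target_block m M t t) (fst ul) (snd ul)"
    using hermitian_eigenbasis[OF target_block_carrier hermitian_target_block[OF M]] by (metis fst_conv snd_conv)
  then obtain ul where ul: "\<And>t. t < 2 \<Longrightarrow> eigenbasis m (target_block m M t t) (fst (ul t)) (snd (ul t))"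
    by metis
  have "eigenbasis (2 * m) (pinch M) (\<lambda>i. target_extend (i mod 2) (fst (ul (i mod 2)) (i div 2)))
      (\<lambda>i. snd (ul (i mod 2)) (i div 2))"
    by (rule eigenbasis_block_diag[of _ _ "\<lambda>t. fst (ul t)" "\<lambda>t. snd (ul t)"])
      (use M ul in \<open>auto simp: target_block_pinch, auto simp: pinch_def\<close>)
  with ul show thesis by (intro that[of "\<lambda>t. fst (ul t)" "\<lambda>t. snd (ul t)"])
qed

lemma trace_target_blocks:
  "(\<Sum>a<2 * m. M $$ (a, a)) = (\<Sum>t<2. \<Sum>r<m. target_block m M t t $$ (r, r))"
  unfolding sum_lessThan_double' by (intro sum.cong refl) simp

text \<open>Gibbs' inequality in the eigenbasis of \<open>pinch M\<close>, weighted with its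
  eigenvalues. Each of these basis vectors is supported on one target value, so \<open>M\<close> and
  \<open>pinch M\<close> have the same diagonal in this basis and the bound is exactly the entropy
  of \<open>pinch M\<close>.\<close>

lemma vn_entropy_pinch:
  assumes "density_mat (2 * m) M"
  shows "vn_entropy M \<le> vn_entropy (pinch M)"
proof -
  obtain u l where u: "\<And>t. t < 2 \<Longrightarrow> eigenbasis m (target_block m M t t) (u t) (l t)"
    and f: "eigenbasis (2 * m) (pinch M) (\<lambda>i. target_extend (i mod 2) (u (i mod 2) (i div 2))) (\<lambda>i. l (i mod 2) (i div 2))"
    using pinch_eigenbasis[OF assms] by blast
  have qf: "quad_form (2 * m) M (target_extend (j mod 2) (u (j mod 2) (j div 2))) = of_real (l (j mod 2) (j div 2))"
    if "j < 2 * m" for j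
    unfolding quad_form_target_extend[OF mod_less_divisor[OF pos2]]
    by (rule quad_form_eigenvector[OF u]) (use that in auto)
  have "complex_of_real (\<Sum>j<2 * m. l (j mod 2) (j div 2)) = (\<Sum>a<2 * m. pinch M $$ (a, a))"
    using sum_eigenvalues[OF f] by simp
  also have "\<dots> = (\<Sum>a<2 * m. M $$ (a, a))"
    using assms by (intro sum.cong refl) (auto simp: pinch_def density_mat_def)
  also have "\<dots> = 1" using assms by (simp add: density_mat_def)
  finally have sum: "(\<Sum>j<2 * m. l (j mod 2) (j div 2)) = 1"
    by (simp only: of_real_eq_1_iff)
  have "vn_entropy M \<le> - (\<Sum>j<2 * m. Re (quad_form (2 * m) M (target_extend (j mod 2) (u (j mod 2) (j div 2)))) *
      log 2 (l (j mod 2) (j div 2)))"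
  proof (rule gibbs_entropy_bound[OF assms f])
    show "0 \<le> l (j mod 2) (j div 2)" if "j < 2 * m" for j
      by (rule eigenvalue_nonneg[OF u quad_form_target_block_nonneg[OF assms]]) (use that in auto)
    show "(\<Sum>j<2 * m. l (j mod 2) (j div 2)) \<le> 1" by (simp only: sum)
    show "quad_form (2 * m) M (target_extend (j mod 2) (u (j mod 2) (j div 2))) = 0"
      if "j < 2 * m" "l (j mod 2) (j div 2) = 0" for j
      using qf[OF that(1)] that(2) by simp
  qed
  also have "\<dots> = vn_entropy (pinch M)"
    unfolding vn_entropy_eigenbasis[OF f] using qf by (intro arg_cong[of _ _ uminus] sum.cong refl) simp
  finally show ?thesis .
qed

lemma density_mat_pinch:
  assumes "density_mat (2 * m) M"
  shows "density_mat (2 * m) (pinch M)"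
proof -
  obtain u l where u: "\<And>t. t < 2 \<Longrightarrow> eigenbasis m (target_block m M t t) (u t) (l t)"
    and f: "eigenbasis (2 * m) (pinch M) (\<lambda>i. target_extend (i mod 2) (u (i mod 2) (i div 2))) (\<lambda>i. l (i mod 2) (i div 2))"
    using pinch_eigenbasis[OF assms] by blast
  have M: "M \<in> carrier_mat (2 * m) (2 * m)" "mat_adjoint M = M" "(\<Sum>a<2 * m. M $$ (a, a)) = 1"
    using assms by (auto simp: density_mat_def)
  have "cnj (M $$ (b, a)) = M $$ (a, b)" if "a < 2 * m" "b < 2 * m" for a b
    using arg_cong[OF M(2), of "\<lambda>M. M $$ (a, b)"] M(1) that by simp
  then have "mat_adjoint (pinch M) = pinch M"
    using M(1) by (intro eq_matI) (auto simp: pinch_def)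
  moreover have "0 \<le> quad_form (2 * m) (pinch M) x" for x
  proof -
    have "0 \<le> l (j mod 2) (j div 2)" if "j < 2 * m" for j
      using eigenvalue_nonneg[OF u quad_form_target_block_nonneg[OF assms]] that
      by (simp add: less_mult_imp_div_less mult.commute)
    then show ?thesis
      unfolding quad_form_eigenbasis[OF f] by (auto simp: less_eq_complex_def intro!: sum_nonneg)
  qed
  moreover have "(\<Sum>a<2 * m. pinch M $$ (a, a)) = (\<Sum>a<2 * m. M $$ (a, a))"
    using M(1) by (intro sum.cong refl) (auto simp: pinch_def)
  moreover have "pinch M \<in> carrier_mat (2 * m) (2 * m)" using M(1) by (simp add: pinch_def)
  ultimately show ?thesis using M(3) unfolding density_mat_def by simp
qed

lemma quad_form_add:
  assumes "A \<in> carrier_mat n n" and "B \<in> carrier_mat n n"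
  shows "quad_form n (A + B) x = quad_form n A x + quad_form n B x"
  using assms unfolding quad_form_def by (simp add: sum.distrib distrib_left distrib_right)

text \<open>Gibbs' inequality in a product basis with product weights. \<open>N\<close> is the
  partial trace of \<open>M\<close> over the target, and \<open>p\<close> is the diagonal of the
  target's reduced state, so its Shannon entropy appears in the bound.\<close>

lemma vn_entropy_subadditive:
  assumes M: "density_mat (2 * m) M"
    and N: "N = target_block m M 0 0 + target_block m M 1 1"
    and p: "\<And>t. t < 2 \<Longrightarrow> (\<Sum>r<m. target_block m M t t $$ (r, r)) = complex_of_real (p t)"
  shows "vn_entropy M \<le> vn_entropy N - (\<Sum>t<2. p t * log 2 (p t))"
proof -
  have Mc: "M \<in> carrier_mat (2 * m) (2 * m)" "mat_adjoint M = M" "(\<Sum>a<2 * m. M $$ (a, a)) = 1"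
    using M by (auto simp: density_mat_def)
  have Nc: "N \<in> carrier_mat m m" by (simp add: N)
  have "cnj (target_block m M t t $$ (b, a)) = target_block m M t t $$ (a, b)" if "a < m" "b < m" "t < 2" for a b t
    using arg_cong[OF hermitian_target_block[OF Mc(1,2) that(3)], of "\<lambda>M. M $$ (a, b)"] that
    by (simp add: target_block_def)
  then have "mat_adjoint N = N"
    by (intro eq_matI) (auto simp: N simp del: target_block_entry)
  then obtain g \<mu> where g: "eigenbasis m N g \<mu>" using hermitian_eigenbasis[OF Nc] by blast
  \<comment> \<open>The joint distribution of outcomes when \<open>M\<close> is measured in the
    product basis; its marginals are \<open>p\<close> and the spectrum \<open>\<mu>\<close> of
    \<open>N\<close>.\<close>
  define w where "w t k = Re (quad_form m (target_block m M t t) (g k))" for t k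
  have w0: "0 \<le> w t k" and w: "quad_form m (target_block m M t t) (g k) = of_real (w t k)" if "t < 2" for t k
    using quad_form_target_block_nonneg[OF M that, of "g k"]
    by (auto simp: w_def less_eq_complex_def complex_eq_iff)
  have wp: "(\<Sum>k<m. w t k) = p t" if "t < 2" for t
    using sum_quad_form_eigenbasis[OF g target_block_carrier, of M t t] p[OF that]
    by (simp add: w[OF that] flip: of_real_sum)
  have w\<mu>: "(\<Sum>t<2. w t k) = \<mu> k" if "k < m" for k
  proof -
    have "complex_of_real (w 0 k + w 1 k) = of_real (\<mu> k)"
      using quad_form_eigenvector[OF g that] unfolding N
      by (simp add: quad_form_add[of _ m] w)
    then show ?thesis by (simp add: lessThan_Suc numeral_2_eq_2 add.commute del: of_real_add)
  qed
  have p0: "0 \<le> p t" if "t < 2" for t using wp[OF that] w0[OF that] by (metis sum_nonneg)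
  have \<mu>0: "0 \<le> \<mu> k" if "k < m" for k using w\<mu>[OF that] w0 by (metis sum_nonneg lessThan_iff)
  have sp: "(\<Sum>t<2. p t) = 1"
    using Mc(3) unfolding trace_target_blocks
    by (simp add: p flip: of_real_sum del: target_block_entry)
  have s\<mu>: "(\<Sum>k<m. \<mu> k) = 1"
  proof -
    have "(\<Sum>k<m. \<mu> k) = (\<Sum>k<m. \<Sum>t<2. w t k)" using w\<mu> by simp
    also have "\<dots> = (\<Sum>t<2. p t)" by (subst sum.swap) (simp add: wp)
    finally show ?thesis using sp by simp
  qed
  \<comment> \<open>This is the identity on the target tensored with \<open>N\<close>; its
    eigenbasis is the required product basis.\<close>
  define B where "B = Matrix.mat (2 * m) (2 * m) (\<lambda>(a, b). if a mod 2 = b mod 2 then N $$ (a div 2, b div 2) else 0)"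
  have f: "eigenbasis (2 * m) B (\<lambda>i. target_extend (i mod 2) (g (i div 2))) (\<lambda>i. \<mu> (i div 2))"
  proof (rule eigenbasis_block_diag[of _ _ "\<lambda>_. g" "\<lambda>_. \<mu>"])
    show "eigenbasis m (target_block m B t t) g \<mu>" if "t < 2" for t
    proof -
      have "target_block m B t t = N"
        using that Nc by (intro eq_matI) (auto simp: target_block_def B_def)
      then show ?thesis using g by simp
    qed
  qed (auto simp: B_def)
  have qf: "quad_form (2 * m) M (target_extend (j mod 2) (g (j div 2))) = of_real (w (j mod 2) (j div 2))" for j
    by (simp add: quad_form_target_extend w)
  \<comment> \<open>A nonnegative joint weight vanishes wherever one of its marginals does. This
    gives the support condition, and it also covers the terms in which the logarithm of the product
    cannot be split.\<close>
  have zero: "w t k = 0" if z: "t < 2" "k < m" "p t * \<mu> k = 0" for t k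
  proof -
    consider "p t = 0" | "\<mu> k = 0" using z(3) by auto
    then show ?thesis
    proof cases
      case 1
      then show ?thesis using wp[OF z(1)] w0[OF z(1)] z(2) by (simp add: sum_nonneg_eq_0_iff)
    next
      case 2
      then show ?thesis
        using sum_nonneg_eq_0_iff[of "{..<2}" "\<lambda>t. w t k"] w\<mu>[OF z(2)] w0[of _ k] z(1) by auto
    qed
  qed
  have "vn_entropy M \<le> - (\<Sum>j<2 * m. Re (quad_form (2 * m) M (target_extend (j mod 2) (g (j div 2)))) *
      log 2 (p (j mod 2) * \<mu> (j div 2)))"
  proof (rule gibbs_entropy_bound[OF M f])
    show "0 \<le> p (j mod 2) * \<mu> (j div 2)" if "j < 2 * m" for j
      using that by (intro mult_nonneg_nonneg p0 \<mu>0) auto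
    have "(\<Sum>j<2 * m. p (j mod 2) * \<mu> (j div 2)) = (\<Sum>t<2. \<Sum>k<m. p t * \<mu> k)"
      unfolding sum_lessThan_double' by (intro sum.cong refl) auto
    then show "(\<Sum>j<2 * m. p (j mod 2) * \<mu> (j div 2)) \<le> 1"
      by (simp add: s\<mu> sp flip: sum_distrib_left)
    show "quad_form (2 * m) M (target_extend (j mod 2) (g (j div 2))) = 0"
      if "j < 2 * m" "p (j mod 2) * \<mu> (j div 2) = 0" for j
      unfolding qf using that by (subst zero) auto
  qed
  also have "(\<Sum>j<2 * m. Re (quad_form (2 * m) M (target_extend (j mod 2) (g (j div 2)))) *
      log 2 (p (j mod 2) * \<mu> (j div 2))) = (\<Sum>t<2. \<Sum>k<m. w t k * log 2 (p t * \<mu> k))"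
    unfolding sum_lessThan_double' qf by (intro sum.cong refl) auto
  also have "\<dots> = (\<Sum>t<2. \<Sum>k<m. w t k * log 2 (p t) + w t k * log 2 (\<mu> k))"
  proof (intro sum.cong refl)
    fix t k assume tk: "t \<in> {..<2 :: nat}" "k \<in> {..<m}"
    show "w t k * log 2 (p t * \<mu> k) = w t k * log 2 (p t) + w t k * log 2 (\<mu> k)"
    proof (cases "p t * \<mu> k = 0")
      case True
      then show ?thesis using zero tk by simp
    next
      case False
      then have "0 < p t" "0 < \<mu> k" using p0[of t] \<mu>0[of k] tk by auto
      then show ?thesis by (simp add: log_mult distrib_left)
    qed
  qed
  also have "\<dots> = (\<Sum>t<2. p t * log 2 (p t)) + (\<Sum>k<m. \<mu> k * log 2 (\<mu> k))"
  proof -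
    have "(\<Sum>t<2. \<Sum>k<m. w t k * log 2 (\<mu> k)) = (\<Sum>k<m. \<mu> k * log 2 (\<mu> k))"
      by (subst sum.swap) (simp add: w\<mu> flip: sum_distrib_right)
    moreover have "(\<Sum>t<2. \<Sum>k<m. w t k * log 2 (p t)) = (\<Sum>t<2. p t * log 2 (p t))"
      by (intro sum.cong refl) (simp add: wp flip: sum_distrib_right)
    ultimately show ?thesis by (simp add: sum.distrib)
  qed
  finally show ?thesis unfolding vn_entropy_eigenbasis[OF g] by simp
qed

text \<open>The spectrum consists of the products \<open>p t * l k\<close>, so the logarithms split.
  The lemma serves both for the state of target and \<open>A\<close>, with weights
  \<open>lam\<close> and \<open>1 - lam\<close>, and for its equatorial dephasing, with both weights
  equal to 1/2.\<close>

lemma vn_entropy_product: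
  assumes \<sigma>: "density_mat m \<sigma>" and M: "M \<in> carrier_mat (2 * m) (2 * m)"
    and p: "\<And>t. t < 2 \<Longrightarrow> 0 \<le> p t"
    and MM: "\<And>t t' r r'. t < 2 \<Longrightarrow> t' < 2 \<Longrightarrow> r < m \<Longrightarrow> r' < m \<Longrightarrow>
      M $$ (t + 2 * r, t' + 2 * r') = of_bool (t = t') * of_real (p t) * \<sigma> $$ (r, r')"
  shows "vn_entropy M = (\<Sum>t<2. p t) * vn_entropy \<sigma> - (\<Sum>t<2. p t * log 2 (p t))"
proof -
  have \<sigma>': "\<sigma> \<in> carrier_mat m m" "mat_adjoint \<sigma> = \<sigma>" "\<And>x. 0 \<le> quad_form m \<sigma> x" "(\<Sum>a<m. \<sigma> $$ (a, a)) = 1"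
    using \<sigma> by (auto simp: density_mat_def)
  obtain u l where u: "eigenbasis m \<sigma> u l" using hermitian_eigenbasis[OF \<sigma>'(1,2)] by blast
  have l0: "0 \<le> l k" if "k < m" for k using eigenvalue_nonneg[OF u \<sigma>'(3) that] .
  have sl: "(\<Sum>k<m. l k) = 1" using sum_eigenvalues[OF u] \<sigma>'(4) by (metis of_real_eq_1_iff)
  have f: "eigenbasis (2 * m) M (\<lambda>i. target_extend (i mod 2) (u (i div 2))) (\<lambda>i. p (i mod 2) * l (i div 2))"
  proof (rule eigenbasis_block_diag[OF M, of "\<lambda>_. u" "\<lambda>t k. p t * l k"])
    show "M $$ (a, b) = 0" if "a < 2 * m" "b < 2 * m" "a mod 2 \<noteq> b mod 2" for a b
      using MM[of "a mod 2" "b mod 2" "a div 2" "b div 2"] that by auto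
    show "eigenbasis m (target_block m M t t) u (\<lambda>k. p t * l k)" if "t < 2" for t
    proof -
      have "target_block m M t t $$ (a, b) = (\<Sum>k<m. of_real (p t * l k) * (u k a * cnj (u k b)))"
        if "a < m" "b < m" for a b
      proof -
        have "target_block m M t t $$ (a, b) = of_real (p t) * \<sigma> $$ (a, b)"
          using that MM[OF \<open>t < 2\<close> \<open>t < 2\<close> that] by simp
        also have "\<dots> = of_real (p t) * (\<Sum>k<m. of_real (l k) * (u k a * cnj (u k b)))"
          using u that by (simp add: eigenbasis_def)
        finally show ?thesis by (simp add: sum_distrib_left mult.assoc)
      qed
      then show ?thesis using u by (simp add: eigenbasis_def)
    qed
  qed
  have "vn_entropy M = - (\<Sum>t<2. \<Sum>k<m. p t * l k * log 2 (p t * l k))"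
    unfolding vn_entropy_eigenbasis[OF f] sum_lessThan_double'
    by (intro arg_cong[of _ _ uminus] sum.cong refl) auto
  also have "(\<Sum>t<2. \<Sum>k<m. p t * l k * log 2 (p t * l k)) =
      (\<Sum>t<2. \<Sum>k<m. l k * (p t * log 2 (p t)) + p t * (l k * log 2 (l k)))"
  proof (intro sum.cong refl)
    fix t k assume tk: "t \<in> {..<2 :: nat}" "k \<in> {..<m}"
    show "p t * l k * log 2 (p t * l k) = l k * (p t * log 2 (p t)) + p t * (l k * log 2 (l k))"
    proof (cases "p t * l k = 0")
      case False
      then have "0 < p t" "0 < l k" using p[of t] l0[of k] tk by auto
      then show ?thesis by (simp add: log_mult distrib_left)
    qed auto
  qed
  also have "\<dots> = (\<Sum>t<2. p t * log 2 (p t)) + (\<Sum>t<2. p t) * (\<Sum>k<m. l k * log 2 (l k))"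
  proof -
    have "(\<Sum>t<2. \<Sum>k<m. l k * (p t * log 2 (p t))) = (\<Sum>t<2. p t * log 2 (p t))"
      by (simp add: sl flip: sum_distrib_right)
    then show ?thesis by (simp add: sum.distrib sum_product)
  qed
  finally show ?thesis unfolding vn_entropy_eigenbasis[OF u] by simp
qed


section \<open>Recovery channels\<close>

text \<open>In \<open>amplify\<close> the spectator is the most significant part of the index,
  \<open>i = a * e + x\<close>, in contrast to the target, which is the lowest bit.\<close>

lemma sum_div_mod:
  "(\<Sum>i<k * e. G (i div e) (i mod e)) = (\<Sum>a<k. \<Sum>x<(e :: nat). G a x :: 'a :: comm_monoid_add)"
proof -
  have "bij_betw (\<lambda>(a, x). a * e + x) ({..<k} \<times> {..<e}) {..<k * e}"
  proof (rule bij_betwI[where g = "\<lambda>i. (i div e, i mod e)"])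
    show "(\<lambda>(a, x). a * e + x) \<in> {..<k} \<times> {..<e} \<rightarrow> {..<k * e}"
    proof (clarsimp)
      fix a x assume "a < k" "x < e"
      then have "a * e + x < Suc a * e" "Suc a * e \<le> k * e" by (simp, intro mult_le_mono1) simp
      then show "a * e + x < k * e" by linarith
    qed
    show "(\<lambda>i. (i div e, i mod e)) \<in> {..<k * e} \<rightarrow> {..<k} \<times> {..<e}"
      by (auto simp: less_mult_imp_div_less intro!: mod_less_divisor) (cases e; simp)
  qed auto
  from sum.reindex_bij_betw[OF this, of "\<lambda>i. G (i div e) (i mod e)", symmetric]
  show ?thesis
    unfolding sum.cartesian_product by (auto intro!: sum.cong)
qed

section \<open>Null vectors of positive forms\<close>

definition sesq_form :: "nat \<Rightarrow> complex mat \<Rightarrow> (nat \<Rightarrow> complex) \<Rightarrow> (nat \<Rightarrow> complex) \<Rightarrow> complex" where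
  "sesq_form n A u w = (\<Sum>a<n. \<Sum>b<n. cnj (u a) * A $$ (a, b) * w b)"

lemma quad_form_add_smult:
  "quad_form n A (\<lambda>a. u a + c * w a) = quad_form n A u + c * sesq_form n A u w +
     cnj c * sesq_form n A w u + c * cnj c * quad_form n A w"
  unfolding quad_form_def sesq_form_def sum_distrib_left sum.distrib[symmetric]
  by (intro sum.cong refl) (simp add: algebra_simps)

text \<open>A null vector of a positive form lies in its kernel: at \<open>u + t * c * w\<close> the
  form is affine in the real number \<open>t\<close>, and being nonnegative for all \<open>t\<close>
  it has slope 0. The choices \<open>c = 1\<close> and \<open>c = \<i>\<close> separate the two
  cross terms.\<close>

lemma sesq_form_eq_0:
  assumes psd: "\<And>x. 0 \<le> quad_form n A x" and w: "quad_form n A w = 0"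
  shows "sesq_form n A u w = 0" and "sesq_form n A w u = 0"
proof -
  define Q where "Q = Re (quad_form n A u)"
  have zero: "c * sesq_form n A u w + cnj c * sesq_form n A w u = 0" for c
  proof -
    define z where "z = c * sesq_form n A u w + cnj c * sesq_form n A w u"
    have *: "0 \<le> quad_form n A u + of_real t * z" for t
      using psd[of "\<lambda>a. u a + (of_real t * c) * w a"] unfolding quad_form_add_smult w z_def
      by (simp add: algebra_simps)
    have "Im z = 0" using *[of 1] psd[of u] by (simp add: less_eq_complex_def)
    moreover have "Re z = 0"
    proof (rule ccontr)
      assume "Re z \<noteq> 0"
      \<comment> \<open>At this value of \<open>t\<close> the form would be equal to -1.\<close>
      then have "(- (Q + 1) / Re z) * Re z = - (Q + 1)" by simp
      moreover have "0 \<le> Q + (- (Q + 1) / Re z) * Re z"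
        using *[of "- (Q + 1) / Re z"] unfolding less_eq_complex_def Q_def plus_complex.sel Re_complex_of_real
          times_complex.sel Im_complex_of_real by simp
      ultimately show False by linarith
    qed
    ultimately have "z = 0" by (simp add: complex_eq_iff)
    then show ?thesis unfolding z_def .
  qed
  have sum: "sesq_form n A u w + sesq_form n A w u = 0" using zero[of 1] by simp
  have "\<i> * (sesq_form n A u w - sesq_form n A w u) = 0" using zero[of \<i>] by (simp add: right_diff_distrib)
  then have eq: "sesq_form n A u w = sesq_form n A w u" by simp
  then show "sesq_form n A u w = 0" "sesq_form n A w u = 0"
    using sum unfolding eq by (simp_all flip: mult_2)
qed

lemma cscalar_prod_quad_form:
  assumes A: "A \<in> carrier_mat n n" and v: "v \<in> carrier_vec n"
  shows "(A *\<^sub>v v) \<bullet>c v = quad_form n A (\<lambda>i. v $ i)"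
proof -
  have Av: "(A *\<^sub>v v) $ i = (\<Sum>j<n. A $$ (i, j) * v $ j)" if "i < n" for i
    using A v that by (simp add: scalar_prod_def lessThan_atLeast0)
  have "(A *\<^sub>v v) \<bullet>c v = (\<Sum>i<n. (A *\<^sub>v v) $ i * cnj (v $ i))"
    using v by (simp add: scalar_prod_def lessThan_atLeast0)
  also have "\<dots> = (\<Sum>i<n. \<Sum>j<n. cnj (v $ i) * A $$ (i, j) * v $ j)"
    using Av by (intro sum.cong refl) (simp add: sum_distrib_left mult_ac)
  finally show ?thesis by (simp add: quad_form_def)
qed

lemma positive_op_quad_form:
  assumes "positive_op n A"
  shows "0 \<le> quad_form n A x"
proof -
  have A: "A \<in> carrier_mat n n" using assms by (simp add: positive_op_def)
  have "quad_form n A x = quad_form n A (\<lambda>i. Matrix.vec n x $ i)"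
    unfolding quad_form_def by (intro sum.cong refl) simp
  also have "\<dots> = (A *\<^sub>v Matrix.vec n x) \<bullet>c Matrix.vec n x"
    by (rule cscalar_prod_quad_form[OF A vec_carrier, symmetric])
  also have "0 \<le> \<dots>"
    using assms unfolding positive_op_def by (blast intro: vec_carrier)
  finally show ?thesis .
qed

definition outer_mat :: "nat \<Rightarrow> (nat \<Rightarrow> complex) \<Rightarrow> (nat \<Rightarrow> complex) \<Rightarrow> complex mat" where
  "outer_mat d f g = Matrix.mat d d (\<lambda>(x, y). f x * cnj (g y))"

lemma outer_mat_carrier [simp]: "outer_mat d f g \<in> carrier_mat d d"
  by (simp add: outer_mat_def)

lemma dim_outer_mat [simp]: "dim_row (outer_mat d f g) = d" "dim_col (outer_mat d f g) = d"
  by (simp_all add: outer_mat_def)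

lemma outer_mat_entry [simp]: "x < d \<Longrightarrow> y < d \<Longrightarrow> outer_mat d f g $$ (x, y) = f x * cnj (g y)"
  by (simp add: outer_mat_def)

lemma positive_op_outer_mat: "positive_op d (outer_mat d f f)"
  unfolding positive_op_def
proof (intro conjI ballI)
  fix v :: "complex vec" assume v: "v \<in> carrier_vec d"
  have "(outer_mat d f f *\<^sub>v v) \<bullet>c v = (\<Sum>x<d. \<Sum>y<d. cnj (v $ x) * (f x * cnj (f y)) * v $ y)"
    unfolding cscalar_prod_quad_form[OF outer_mat_carrier v] quad_form_def by (intro sum.cong refl) simp
  also have "\<dots> = (\<Sum>x<d. f x * cnj (v $ x)) * cnj (\<Sum>x<d. f x * cnj (v $ x))"
    by (simp add: sum_product mult_ac)
  also have "\<dots> = complex_of_real ((cmod (\<Sum>x<d. f x * cnj (v $ x)))\<^sup>2)"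
    by (rule complex_norm_square[symmetric])
  finally have eq: "(outer_mat d f f *\<^sub>v v) \<bullet>c v = complex_of_real ((cmod (\<Sum>x<d. f x * cnj (v $ x)))\<^sup>2)" .
  show "0 \<le> (outer_mat d f f *\<^sub>v v) \<bullet>c v"
    unfolding eq less_eq_complex_def Re_complex_of_real Im_complex_of_real by simp
qed simp

lemma sum_of_bool_mult: "finite A \<Longrightarrow> i \<in> A \<Longrightarrow> (\<Sum>a\<in>A. of_bool (a = i) * f a) = (f i :: complex)"
  by (simp add: of_bool_def if_distrib[of "\<lambda>x. x * _"] cong: if_cong)

lemma cnj_of_bool: "cnj (of_bool P) = of_bool P"
  by (cases P) auto

text \<open>An extension of a pure state is a product state: for \<open>w\<close> orthogonal to \<open>\<psi>\<close>, the quadratic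
  form takes nonnegative values at the vectors \<open>a \<otimes> w\<close> that sum to 0, so the matrix annihilates them.\<close>

lemma blocks_of_pure_marginal:
  fixes F :: "nat \<Rightarrow> nat \<Rightarrow> complex mat"
  assumes W: "positive_op (k * e) (Matrix.mat (k * e) (k * e) (\<lambda>(i, j). F (i div e) (j div e) $$ (i mod e, j mod e)))"
    and marg: "\<And>i j. i < e \<Longrightarrow> j < e \<Longrightarrow> (\<Sum>a<k. F a a $$ (i, j)) = \<psi> i * cnj (\<psi> j)"
    and unit: "(\<Sum>i<e. cnj (\<psi> i) * \<psi> i) = 1"
    and ab: "a < k" "b < k" and ij: "i < e" "j < e"
  shows "F a b $$ (i, j) = (\<Sum>l<e. F a b $$ (l, l)) * (\<psi> i * cnj (\<psi> j))"
proof -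
  define W where "W = Matrix.mat (k * e) (k * e) (\<lambda>(i, j). F (i div e) (j div e) $$ (i mod e, j mod e))"
  \<comment> \<open>The vector \<open>a \<otimes> w\<close>; forms at two such vectors pick out a
    single block of \<open>W\<close>.\<close>
  define embed where "embed a w = (\<lambda>i. of_bool (i div e = a) * w (i mod e))" for a and w :: "nat \<Rightarrow> complex"
  have psd: "0 \<le> quad_form (k * e) W x" for x
    using positive_op_quad_form[OF assms(1)] by (simp add: W_def)
  have form: "sesq_form (k * e) W (embed a u) (embed b w) = sesq_form e (F a b) u w" if "a < k" "b < k" for a b u w
  proof -
    define H where "H a' i b' j =
      of_bool (a' = a) * (of_bool (b' = b) * (cnj (u i) * F a' b' $$ (i, j) * w j))" for a' i b' j
    have "sesq_form (k * e) W (embed a u) (embed b w) =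
        (\<Sum>i<k * e. \<Sum>j<k * e. H (i div e) (i mod e) (j div e) (j mod e))"
      unfolding sesq_form_def by (intro sum.cong refl) (simp add: W_def H_def embed_def)
    also have "\<dots> = (\<Sum>i<k * e. \<Sum>b'<k. \<Sum>j<e. H (i div e) (i mod e) b' j)"
      by (intro sum.cong refl sum_div_mod)
    also have "\<dots> = (\<Sum>a'<k. \<Sum>i<e. \<Sum>b'<k. \<Sum>j<e. H a' i b' j)"
      by (rule sum_div_mod)
    also have "\<dots> = (\<Sum>a'<k. of_bool (a' = a) * (\<Sum>i<e. \<Sum>b'<k. of_bool (b' = b) *
        (\<Sum>j<e. cnj (u i) * F a' b' $$ (i, j) * w j)))"
      by (simp only: H_def sum_distrib_left)
    also have "\<dots> = sesq_form e (F a b) u w"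
      using that by (simp add: sesq_form_def sum_of_bool_mult)
    finally show ?thesis .
  qed
  have quad: "quad_form (k * e) W (embed a w) = quad_form e (F a a) w" if "a < k" for a w
    using form[OF that that, of w w] by (simp add: quad_form_def sesq_form_def)
  have perp: "sesq_form e (F a b) u w = 0" "sesq_form e (F a b) w u = 0"
    if w: "(\<Sum>i<e. cnj (\<psi> i) * w i) = 0" and "a < k" "b < k" for a b u w
  proof -
    have "(\<Sum>a<k. quad_form e (F a a) w) = (\<Sum>i<e. \<Sum>j<e. \<Sum>a<k. cnj (w i) * F a a $$ (i, j) * w j)"
      unfolding quad_form_def by (subst sum.swap, rule sum.cong[OF refl], rule sum.swap)
    also have "\<dots> = (\<Sum>i<e. \<Sum>j<e. cnj (w i) * (\<psi> i * cnj (\<psi> j)) * w j)"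
      by (intro sum.cong refl) (simp add: marg flip: sum_distrib_left sum_distrib_right)
    also have "\<dots> = (\<Sum>i<e. cnj (w i) * \<psi> i) * (\<Sum>j<e. cnj (\<psi> j) * w j)"
      by (simp add: sum_product mult_ac)
    finally have "(\<Sum>a<k. quad_form e (F a a) w) = 0" using w by simp
    moreover have "0 \<le> quad_form e (F a a) w" if "a < k" for a
      using psd[of "embed a w"] quad[OF that] by simp
    ultimately have "quad_form e (F a a) w = 0" if "a < k" for a
      using that by (subst (asm) sum_nonneg_eq_0_iff) auto
    then have *: "quad_form (k * e) W (embed a w) = 0" if "a < k" for a using quad that by simp
    show "sesq_form e (F a b) u w = 0" "sesq_form e (F a b) w u = 0"
      using sesq_form_eq_0[OF psd *] form that(2,3) by metis+
  qed
  \<comment> \<open>The component of the \<open>l\<close>-th basis vector orthogonal to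
    \<open>\<psi>\<close>. Since every block annihilates it on both sides, a basis vector can be
    replaced by its component along \<open>\<psi>\<close>.\<close>
  define proj where "proj l = (\<lambda>i. of_bool (i = l) - \<psi> i * cnj (\<psi> l))" for l
  have proj: "(\<Sum>i<e. cnj (\<psi> i) * proj l i) = 0" if "l < e" for l
  proof -
    have "(\<Sum>i<e. cnj (\<psi> i) * proj l i) =
        (\<Sum>i<e. of_bool (i = l) * cnj (\<psi> i)) - (\<Sum>i<e. cnj (\<psi> i) * \<psi> i) * cnj (\<psi> l)"
      unfolding proj_def sum_distrib_right sum_subtractf[symmetric]
      by (intro sum.cong refl) (simp add: algebra_simps)
    then show ?thesis using that unit by (simp add: sum_of_bool_mult)
  qed
  \<comment> \<open>Annihilation on the right makes each row a multiple of the conjugate of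
    \<open>\<psi>\<close>, on the left each column a multiple of \<open>\<psi>\<close>. Together the
    block is \<open>s\<close> times the projector onto \<open>\<psi>\<close>, and the unit norm
    identifies \<open>s\<close> as its trace.\<close>
  define h where "h i = (\<Sum>j<e. F a b $$ (i, j) * \<psi> j)" for i
  define s where "s = (\<Sum>i<e. cnj (\<psi> i) * h i)"
  have right: "F a b $$ (i, j) = h i * cnj (\<psi> j)" if "i < e" "j < e" for i j
  proof -
    have "0 = sesq_form e (F a b) (\<lambda>l. of_bool (l = i)) (proj j)" using perp(1)[OF proj ab] that by simp
    also have "\<dots> = (\<Sum>a'<e. of_bool (a' = i) * (\<Sum>b'<e. F a b $$ (a', b') * proj j b'))"
      by (simp only: sesq_form_def cnj_of_bool sum_distrib_left mult.assoc)
    also have "\<dots> = (\<Sum>b'<e. F a b $$ (i, b') * proj j b')" using that by (simp add: sum_of_bool_mult)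
    also have "\<dots> = (\<Sum>b'<e. of_bool (b' = j) * F a b $$ (i, b')) - h i * cnj (\<psi> j)"
      unfolding proj_def h_def sum_distrib_right sum_subtractf[symmetric]
      by (intro sum.cong refl) (simp add: algebra_simps)
    finally show ?thesis using that by (simp add: sum_of_bool_mult)
  qed
  have left: "F a b $$ (i, j) = \<psi> i * (\<Sum>l<e. cnj (\<psi> l) * F a b $$ (l, j))" if "i < e" "j < e" for i j
  proof -
    have "0 = sesq_form e (F a b) (proj i) (\<lambda>l. of_bool (l = j))" using perp(2)[OF proj ab] that by simp
    also have "\<dots> = (\<Sum>b'<e. of_bool (b' = j) * (\<Sum>a'<e. cnj (proj i a') * F a b $$ (a', b')))"
      unfolding sesq_form_def
      by (subst sum.swap, rule sum.cong[OF refl]) (simp only: sum_distrib_left mult_ac)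
    also have "\<dots> = (\<Sum>a'<e. cnj (proj i a') * F a b $$ (a', j))" using that by (simp add: sum_of_bool_mult)
    also have "\<dots> = (\<Sum>a'<e. of_bool (a' = i) * F a b $$ (a', j)) - \<psi> i * (\<Sum>l<e. cnj (\<psi> l) * F a b $$ (l, j))"
      unfolding proj_def sum_distrib_left sum_subtractf[symmetric]
      by (intro sum.cong refl) (simp add: algebra_simps)
    finally show ?thesis using that by (simp add: sum_of_bool_mult)
  qed
  have F: "F a b $$ (i, j) = s * (\<psi> i * cnj (\<psi> j))" if "i < e" "j < e" for i j
  proof -
    have "(\<Sum>l<e. cnj (\<psi> l) * F a b $$ (l, j)) = s * cnj (\<psi> j)"
      unfolding s_def sum_distrib_right using that right by (intro sum.cong refl) simp
    then show ?thesis using left[OF that] by simp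
  qed
  have "(\<Sum>l<e. F a b $$ (l, l)) = (\<Sum>l<e. s * (cnj (\<psi> l) * \<psi> l))"
    using F by (intro sum.cong refl) simp
  then have "(\<Sum>l<e. F a b $$ (l, l)) = s" using unit by (simp flip: sum_distrib_left)
  then show ?thesis using F[OF ij] by simp
qed

section \<open>From recovery to decoupling\<close>

lemma quantum_channel_sum:
  fixes k :: nat
  assumes R: "quantum_channel d e R" and M: "\<And>a. a < k \<Longrightarrow> M a \<in> carrier_mat d d"
    and ij: "i < e" "j < e"
  shows "R (Matrix.mat d d (\<lambda>(x, y). \<Sum>a<k. c a * M a $$ (x, y))) $$ (i, j) = (\<Sum>a<k. c a * R (M a) $$ (i, j))"
  using M
proof (induction k)
  case 0
  have lin: "R (0 \<cdot>\<^sub>m 0\<^sub>m d d) = 0 \<cdot>\<^sub>m R (0\<^sub>m d d)" and c: "R (0\<^sub>m d d) \<in> carrier_mat e e"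
    using R zero_carrier_mat unfolding quantum_channel_def by blast+
  have Z: "Matrix.mat d d (\<lambda>(x, y). \<Sum>a<0. c a * M a $$ (x, y)) = 0 \<cdot>\<^sub>m 0\<^sub>m d d" by (rule eq_matI) auto
  show ?case unfolding Z lin using c ij by simp
next
  case (Suc k)
  define L where "L = Matrix.mat d d (\<lambda>(x, y). \<Sum>a<k. c a * M a $$ (x, y))"
  have L: "L \<in> carrier_mat d d" by (simp add: L_def)
  have Mk: "M k \<in> carrier_mat d d" "c k \<cdot>\<^sub>m M k \<in> carrier_mat d d" using Suc.prems by auto
  have c: "R L \<in> carrier_mat e e" "R (M k) \<in> carrier_mat e e" using R L Mk by (auto simp: quantum_channel_def)
  have sum: "Matrix.mat d d (\<lambda>(x, y). \<Sum>a<Suc k. c a * M a $$ (x, y)) = L + c k \<cdot>\<^sub>m M k"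
    using Mk by (intro eq_matI) (auto simp: L_def)
  have lin: "R (L + c k \<cdot>\<^sub>m M k) = R L + c k \<cdot>\<^sub>m R (M k)"
    using R L Mk unfolding quantum_channel_def by metis
  have "R L $$ (i, j) = (\<Sum>a<k. c a * R (M a) $$ (i, j))"
    unfolding L_def by (rule Suc.IH) (use Suc.prems in auto)
  then show ?case unfolding sum lin using ij c by simp
qed

text \<open>\<open>\<phi> a\<close> is the piece of a pure state belonging to the value
  \<open>a\<close> of the spectator. The channel acts on the whole pure state with the spectator
  left alone: the blocks of the result are the images of the outer products of pieces, their
  diagonal sum is the given pure output, and trace preservation evaluates the scalar factor.\<close>

lemma quantum_channel_pure_output:
  fixes \<phi> :: "nat \<Rightarrow> nat \<Rightarrow> complex" and k :: nat
  assumes R: "quantum_channel d e R"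
    and out: "R (Matrix.mat d d (\<lambda>(x, y). \<Sum>a<k. \<phi> a x * cnj (\<phi> a y))) = outer_mat e \<psi> \<psi>"
    and unit: "(\<Sum>i<e. cnj (\<psi> i) * \<psi> i) = 1"
    and ab: "a < k" "b < k" and ij: "i < e" "j < e"
  shows "R (outer_mat d (\<phi> a) (\<phi> b)) $$ (i, j) = (\<Sum>x<d. \<phi> a x * cnj (\<phi> b x)) * (\<psi> i * cnj (\<psi> j))"
proof -
  define F where "F a b = R (outer_mat d (\<phi> a) (\<phi> b))" for a b
  \<comment> \<open>The pieces written one after the other, in the index order of
    \<open>amplify\<close>.\<close>
  define g where "g i = \<phi> (i div d) (i mod d)" for i
  have "amplify k d e R (outer_mat (k * d) g g) =
      Matrix.mat (k * e) (k * e) (\<lambda>(i, j). F (i div e) (j div e) $$ (i mod e, j mod e))"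
    unfolding amplify_def
  proof (rule cong_mat[OF refl refl], clarify)
    fix i j assume "i < k * e" "j < k * e"
    then have "i div e < k" "j div e < k" by (auto simp: less_mult_imp_div_less)
    then have less: "i div e * d + x < k * d" "j div e * d + x < k * d" if "x < d" for x
    proof -
      have "a * d + x < k * d" if "a < k" for a
      proof -
        have "a * d + x < Suc a * d" using \<open>x < d\<close> by simp
        also have "\<dots> \<le> k * d" using that by (intro mult_le_mono1) simp
        finally show ?thesis .
      qed
      then show "i div e * d + x < k * d" "j div e * d + x < k * d"
        using \<open>i div e < k\<close> \<open>j div e < k\<close> by auto
    qed
    have "Matrix.mat d d (\<lambda>(a, b). outer_mat (k * d) g g $$ (i div e * d + a, j div e * d + b)) =
        outer_mat d (\<phi> (i div e)) (\<phi> (j div e))"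
      by (rule eq_matI) (auto simp: less g_def)
    then show "R (Matrix.mat d d (\<lambda>(a, b). outer_mat (k * d) g g $$ (i div e * d + a, j div e * d + b))) $$ (i mod e, j mod e) =
        F (i div e) (j div e) $$ (i mod e, j mod e)"
      by (simp add: F_def)
  qed
  moreover have "positive_op (k * e) (amplify k d e R (outer_mat (k * d) g g))"
    using R positive_op_outer_mat unfolding quantum_channel_def by blast
  ultimately have pos: "positive_op (k * e) (Matrix.mat (k * e) (k * e) (\<lambda>(i, j). F (i div e) (j div e) $$ (i mod e, j mod e)))"
    by simp
  have marg: "(\<Sum>a<k. F a a $$ (i, j)) = \<psi> i * cnj (\<psi> j)" if "i < e" "j < e" for i j
  proof -
    have "Matrix.mat d d (\<lambda>(x, y). \<Sum>a<k. 1 * outer_mat d (\<phi> a) (\<phi> a) $$ (x, y)) =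
        Matrix.mat d d (\<lambda>(x, y). \<Sum>a<k. \<phi> a x * cnj (\<phi> a y))"
      by (rule eq_matI) auto
    then have "(\<Sum>a<k. 1 * F a a $$ (i, j)) = outer_mat e \<psi> \<psi> $$ (i, j)"
      unfolding F_def out[symmetric]
      by (subst quantum_channel_sum[OF R _ that, symmetric]) simp_all
    then show ?thesis using that by simp
  qed
  have "(\<Sum>l<e. F a b $$ (l, l)) = (\<Sum>x<d. outer_mat d (\<phi> a) (\<phi> b) $$ (x, x))"
    using R unfolding quantum_channel_def F_def by simp
  also have "\<dots> = (\<Sum>x<d. \<phi> a x * cnj (\<phi> b x))" by simp
  finally show ?thesis
    using blocks_of_pure_marginal[OF pos marg unit ab ij] by (simp add: F_def)
qed

text \<open>The right-hand sides are quartic in \<open>(\<alpha>, \<beta>)\<close>, the left-hand sides quadratic; the values at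
  \<open>\<alpha> = 1 / sqrt 2\<close>, \<open>\<beta> = \<omega> / sqrt 2\<close> for the fourth roots of unity \<open>\<omega>\<close> separate the powers of \<open>\<omega>\<close>.\<close>

lemma phase_comparison:
  fixes x1 x2 x3 x4 y1 y2 y3 y4 s1 s2 s3 s4 :: complex
  defines "S \<equiv> \<lambda>\<alpha> \<beta>. \<alpha> * cnj \<alpha> * s1 + \<alpha> * cnj \<beta> * s2 + \<beta> * cnj \<alpha> * s3 + \<beta> * cnj \<beta> * s4"
  assumes x: "\<And>\<alpha> \<beta>. \<alpha> * cnj \<alpha> + \<beta> * cnj \<beta> = 1 \<Longrightarrow>
      \<alpha> * cnj \<alpha> * x1 + \<alpha> * cnj \<beta> * x2 + \<beta> * cnj \<alpha> * x3 + \<beta> * cnj \<beta> * x4 = S \<alpha> \<beta> * (\<alpha> * cnj \<beta>)"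
    and y: "\<And>\<alpha> \<beta>. \<alpha> * cnj \<alpha> + \<beta> * cnj \<beta> = 1 \<Longrightarrow>
      \<alpha> * cnj \<alpha> * y1 + \<alpha> * cnj \<beta> * y2 + \<beta> * cnj \<alpha> * y3 + \<beta> * cnj \<beta> * y4 = S \<alpha> \<beta> * (\<alpha> * cnj \<alpha>)"
  shows "s2 = 0" and "s3 = 0" and "s1 = s4"
proof -
  define c where "c = complex_of_real (1 / sqrt 2)"
  have cc: "cnj c = c" by (simp add: c_def)
  have "c * c = complex_of_real ((1 / sqrt 2) * (1 / sqrt 2))" unfolding c_def of_real_mult ..
  also have "\<dots> = 1 / 2" by simp
  finally have c2: "c * c = 1 / 2" .
  \<comment> \<open>The points \<open>(1, 0)\<close> and \<open>(0, 1)\<close> determine the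
    diagonal coefficients on the left.\<close>
  have x1: "x1 = 0" "x4 = 0" and y1: "y1 = s1" "y4 = 0"
    using x[of 1 0] x[of 0 1] y[of 1 0] y[of 0 1] by (simp_all add: S_def)
  have w: "c * cnj c + (c * \<omega>) * cnj (c * \<omega>) = 1" "c * cnj c = 1 / 2"
    "c * cnj (c * \<omega>) = cnj \<omega> / 2" "c * \<omega> * cnj c = \<omega> / 2" "c * \<omega> * cnj (c * \<omega>) = 1 / 2"
    if "\<omega> * cnj \<omega> = 1" for \<omega>
  proof -
    show "c * cnj c = 1 / 2" "c * cnj (c * \<omega>) = cnj \<omega> / 2" "c * \<omega> * cnj c = \<omega> / 2"
      using c2 by (simp_all add: cc mult.assoc[symmetric])
    have "c * \<omega> * cnj (c * \<omega>) = (c * c) * (\<omega> * cnj \<omega>)" by (simp add: cc mult_ac)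
    then show *: "c * \<omega> * cnj (c * \<omega>) = 1 / 2" using that c2 by simp
    show "c * cnj c + (c * \<omega>) * cnj (c * \<omega>) = 1" unfolding * cc c2 by simp
  qed
  have X: "cnj \<omega> / 2 * x2 + \<omega> / 2 * x3 = (s1 / 2 + cnj \<omega> / 2 * s2 + \<omega> / 2 * s3 + s4 / 2) * (cnj \<omega> / 2)"
    and Y: "s1 / 2 + cnj \<omega> / 2 * y2 + \<omega> / 2 * y3 = (s1 / 2 + cnj \<omega> / 2 * s2 + \<omega> / 2 * s3 + s4 / 2) * (1 / 2)"
    if "\<omega> * cnj \<omega> = 1" for \<omega>
    using x[OF w(1)[OF that]] y[OF w(1)[OF that]] unfolding S_def w[OF that] x1 y1 by simp_all
  \<comment> \<open>In \<open>X\<close> the left-hand side is odd in \<open>\<omega>\<close>, so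
    adding the equations at \<open>\<omega>\<close> and \<open>- \<omega>\<close> removes the
    unknowns \<open>x2\<close> and \<open>x3\<close>. The pair 1, -1 gives
    \<open>s2 + s3 = 0\<close> and the pair \<open>\<i>\<close>, \<open>- \<i>\<close> gives
    \<open>s2 = s3\<close>. In \<open>Y\<close> the same addition removes \<open>y2\<close> and
    \<open>y3\<close>, leaving \<open>s1 = s4\<close>.\<close>
  have "Re s2 + Re s3 = 0"
    using arg_cong[OF X[of 1], of Re] arg_cong[OF X[of "- 1"], of Re]
    by (simp add: add_divide_distrib diff_divide_distrib)
  moreover have "Im s2 + Im s3 = 0"
    using arg_cong[OF X[of 1], of Im] arg_cong[OF X[of "- 1"], of Im]
    by (simp add: add_divide_distrib diff_divide_distrib)
  moreover have "Re s2 = Re s3"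
    using arg_cong[OF X[of \<i>], of Re] arg_cong[OF X[of "- \<i>"], of Re]
    by (simp add: add_divide_distrib diff_divide_distrib)
  moreover have "Im s2 = Im s3"
    using arg_cong[OF X[of \<i>], of Im] arg_cong[OF X[of "- \<i>"], of Im]
    by (simp add: add_divide_distrib diff_divide_distrib)
  ultimately show s: "s2 = 0" "s3 = 0" by (simp_all add: complex_eq_iff)
  have "Re s1 = Re s4"
    using arg_cong[OF Y[of 1], of Re] arg_cong[OF Y[of "- 1"], of Re]
    by (simp add: s add_divide_distrib diff_divide_distrib)
  moreover have "Im s1 = Im s4"
    using arg_cong[OF Y[of 1], of Im] arg_cong[OF Y[of "- 1"], of Im]
    by (simp add: s add_divide_distrib diff_divide_distrib)
  ultimately show "s1 = s4" by (simp add: complex_eq_iff)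
qed

text \<open>The Knill-Laflamme conditions in terms of overlaps: tracing out all but the spectator,
  the outer products of the two code vectors leave 0 for different vectors and the same operator for
  equal ones.\<close>

lemma code_blocks_decoupled:
  fixes \<phi>0 \<phi>1 :: "nat \<Rightarrow> nat \<Rightarrow> complex" and k :: nat
  assumes R: "quantum_channel d e R"
    and \<psi>: "(\<Sum>i<e. cnj (\<psi>0 i) * \<psi>0 i) = 1" "(\<Sum>i<e. cnj (\<psi>1 i) * \<psi>1 i) = 1" "(\<Sum>i<e. cnj (\<psi>0 i) * \<psi>1 i) = 0"
    and out: "\<And>\<alpha> \<beta>. \<alpha> * cnj \<alpha> + \<beta> * cnj \<beta> = 1 \<Longrightarrow>
      R (Matrix.mat d d (\<lambda>(x, y). \<Sum>a<k. (\<alpha> * \<phi>0 a x + \<beta> * \<phi>1 a x) * cnj (\<alpha> * \<phi>0 a y + \<beta> * \<phi>1 a y))) =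
      outer_mat e (\<lambda>i. \<alpha> * \<psi>0 i + \<beta> * \<psi>1 i) (\<lambda>i. \<alpha> * \<psi>0 i + \<beta> * \<psi>1 i)"
    and ab: "a < k" "b < k"
  shows "(\<Sum>x<d. \<phi>0 a x * cnj (\<phi>1 b x)) = 0"
    and "(\<Sum>x<d. \<phi>1 a x * cnj (\<phi>0 b x)) = 0"
    and "(\<Sum>x<d. \<phi>0 a x * cnj (\<phi>0 b x)) = (\<Sum>x<d. \<phi>1 a x * cnj (\<phi>1 b x))"
proof -
  define O1 where "O1 = outer_mat d (\<phi>0 a) (\<phi>0 b)"
  define O2 where "O2 = outer_mat d (\<phi>0 a) (\<phi>1 b)"
  define O3 where "O3 = outer_mat d (\<phi>1 a) (\<phi>0 b)"
  define O4 where "O4 = outer_mat d (\<phi>1 a) (\<phi>1 b)"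
  define S where "S \<alpha> \<beta> = \<alpha> * cnj \<alpha> * (\<Sum>x<d. \<phi>0 a x * cnj (\<phi>0 b x)) + \<alpha> * cnj \<beta> * (\<Sum>x<d. \<phi>0 a x * cnj (\<phi>1 b x)) +
      \<beta> * cnj \<alpha> * (\<Sum>x<d. \<phi>1 a x * cnj (\<phi>0 b x)) + \<beta> * cnj \<beta> * (\<Sum>x<d. \<phi>1 a x * cnj (\<phi>1 b x))" for \<alpha> \<beta>
  have conj: "(\<Sum>i<e. cnj (\<psi>1 i) * \<psi>0 i) = 0"
    using arg_cong[OF \<psi>(3), of cnj] by (simp add: mult.commute)
  \<comment> \<open>The same entry is computed twice: linearity of \<open>R\<close> expands it over
    the four outer products, and purity of the output makes it a scalar times the recovered
    projector.\<close>
  have entries: "\<alpha> * cnj \<alpha> * R O1 $$ (i, j) + \<alpha> * cnj \<beta> * R O2 $$ (i, j) + \<beta> * cnj \<alpha> * R O3 $$ (i, j) + \<beta> * cnj \<beta> * R O4 $$ (i, j) =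
      S \<alpha> \<beta> * ((\<alpha> * \<psi>0 i + \<beta> * \<psi>1 i) * cnj (\<alpha> * \<psi>0 j + \<beta> * \<psi>1 j))"
    if \<alpha>\<beta>: "\<alpha> * cnj \<alpha> + \<beta> * cnj \<beta> = 1" and ij: "i < e" "j < e" for \<alpha> \<beta> i j
  proof -
    define f where "f a x = \<alpha> * \<phi>0 a x + \<beta> * \<phi>1 a x" for a x
    have "(\<Sum>i<e. cnj (\<alpha> * \<psi>0 i + \<beta> * \<psi>1 i) * (\<alpha> * \<psi>0 i + \<beta> * \<psi>1 i)) =
        \<alpha> * cnj \<alpha> * (\<Sum>i<e. cnj (\<psi>0 i) * \<psi>0 i) + \<beta> * cnj \<alpha> * (\<Sum>i<e. cnj (\<psi>0 i) * \<psi>1 i) +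
        \<alpha> * cnj \<beta> * (\<Sum>i<e. cnj (\<psi>1 i) * \<psi>0 i) + \<beta> * cnj \<beta> * (\<Sum>i<e. cnj (\<psi>1 i) * \<psi>1 i)"
      unfolding sum_distrib_left sum.distrib[symmetric] by (rule sum.cong[OF refl]) (simp add: algebra_simps)
    then have unit: "(\<Sum>i<e. cnj (\<alpha> * \<psi>0 i + \<beta> * \<psi>1 i) * (\<alpha> * \<psi>0 i + \<beta> * \<psi>1 i)) = 1"
      unfolding \<psi> conj using \<alpha>\<beta> by simp
    have S: "(\<Sum>x<d. f a x * cnj (f b x)) = S \<alpha> \<beta>"
      unfolding S_def f_def sum_distrib_left sum.distrib[symmetric]
      by (rule sum.cong[OF refl]) (simp add: algebra_simps)
    define c where "c = (!) [\<alpha> * cnj \<alpha>, \<alpha> * cnj \<beta>, \<beta> * cnj \<alpha>, \<beta> * cnj \<beta>]"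
    define M where "M = (!) [O1, O2, O3, O4]"
    have M: "M s \<in> carrier_mat d d" if "s < 4" for s
      using that unfolding M_def O1_def O2_def O3_def O4_def
      by (auto simp: less_Suc_eq numeral_eq_Suc)
    have four: "(\<Sum>s<4. g s) = g 0 + g 1 + g 2 + g 3" for g :: "nat \<Rightarrow> complex"
      by (simp add: numeral_eq_Suc lessThan_Suc add_ac)
    have "outer_mat d (f a) (f b) = Matrix.mat d d (\<lambda>(x, y). \<Sum>s<4. c s * M s $$ (x, y))"
      by (rule eq_matI)
        (simp_all add: four c_def M_def O1_def O2_def O3_def O4_def f_def numeral_eq_Suc algebra_simps)
    then have "(\<Sum>s<4. c s * R (M s) $$ (i, j)) = R (outer_mat d (f a) (f b)) $$ (i, j)"
      using quantum_channel_sum[where k = 4 and c = c, OF R M ij] by simp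
    also have "\<dots> = S \<alpha> \<beta> * ((\<alpha> * \<psi>0 i + \<beta> * \<psi>1 i) * cnj (\<alpha> * \<psi>0 j + \<beta> * \<psi>1 j))"
      using quantum_channel_pure_output[OF R out[OF \<alpha>\<beta>, folded f_def] unit ab ij] unfolding S .
    finally show ?thesis unfolding four by (simp add: c_def M_def numeral_eq_Suc)
  qed
  have forms: "\<alpha> * cnj \<alpha> * sesq_form e (R O1) u w + \<alpha> * cnj \<beta> * sesq_form e (R O2) u w +
      \<beta> * cnj \<alpha> * sesq_form e (R O3) u w + \<beta> * cnj \<beta> * sesq_form e (R O4) u w =
      S \<alpha> \<beta> * ((\<Sum>i<e. cnj (u i) * (\<alpha> * \<psi>0 i + \<beta> * \<psi>1 i)) * (\<Sum>j<e. cnj (\<alpha> * \<psi>0 j + \<beta> * \<psi>1 j) * w j))"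
    if \<alpha>\<beta>: "\<alpha> * cnj \<alpha> + \<beta> * cnj \<beta> = 1" for \<alpha> \<beta> u w
  proof -
    have "\<alpha> * cnj \<alpha> * sesq_form e (R O1) u w + \<alpha> * cnj \<beta> * sesq_form e (R O2) u w +
        \<beta> * cnj \<alpha> * sesq_form e (R O3) u w + \<beta> * cnj \<beta> * sesq_form e (R O4) u w =
      (\<Sum>i<e. \<Sum>j<e. cnj (u i) * (\<alpha> * cnj \<alpha> * R O1 $$ (i, j) + \<alpha> * cnj \<beta> * R O2 $$ (i, j) +
        \<beta> * cnj \<alpha> * R O3 $$ (i, j) + \<beta> * cnj \<beta> * R O4 $$ (i, j)) * w j)"
      unfolding sesq_form_def sum_distrib_left sum.distrib[symmetric]
      by (rule sum.cong[OF refl], rule sum.cong[OF refl]) (simp only: distrib_left distrib_right mult_ac)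
    also have "\<dots> = (\<Sum>i<e. \<Sum>j<e. S \<alpha> \<beta> * ((cnj (u i) * (\<alpha> * \<psi>0 i + \<beta> * \<psi>1 i)) * (cnj (\<alpha> * \<psi>0 j + \<beta> * \<psi>1 j) * w j)))"
      using entries[OF \<alpha>\<beta>]
      by (intro sum.cong[OF refl]) (simp only: lessThan_iff mult_ac)
    finally show ?thesis by (simp only: sum_product) (simp only: sum_distrib_left)
  qed
  have ip: "(\<Sum>i<e. cnj (\<psi>0 i) * (\<alpha> * \<psi>0 i + \<beta> * \<psi>1 i)) = \<alpha>"
    "(\<Sum>j<e. cnj (\<alpha> * \<psi>0 j + \<beta> * \<psi>1 j) * \<psi>0 j) = cnj \<alpha>"
    "(\<Sum>j<e. cnj (\<alpha> * \<psi>0 j + \<beta> * \<psi>1 j) * \<psi>1 j) = cnj \<beta>" for \<alpha> \<beta>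
  proof -
    have "(\<Sum>i<e. cnj (\<psi>0 i) * (\<alpha> * \<psi>0 i + \<beta> * \<psi>1 i)) =
        \<alpha> * (\<Sum>i<e. cnj (\<psi>0 i) * \<psi>0 i) + \<beta> * (\<Sum>i<e. cnj (\<psi>0 i) * \<psi>1 i)"
      unfolding sum_distrib_left sum.distrib[symmetric] by (rule sum.cong[OF refl]) (simp add: algebra_simps)
    then show "(\<Sum>i<e. cnj (\<psi>0 i) * (\<alpha> * \<psi>0 i + \<beta> * \<psi>1 i)) = \<alpha>" by (simp add: \<psi>)
    have "(\<Sum>j<e. cnj (\<alpha> * \<psi>0 j + \<beta> * \<psi>1 j) * \<psi>0 j) =
        cnj \<alpha> * (\<Sum>i<e. cnj (\<psi>0 i) * \<psi>0 i) + cnj \<beta> * (\<Sum>i<e. cnj (\<psi>1 i) * \<psi>0 i)"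
      unfolding sum_distrib_left sum.distrib[symmetric] by (rule sum.cong[OF refl]) (simp add: algebra_simps)
    then show "(\<Sum>j<e. cnj (\<alpha> * \<psi>0 j + \<beta> * \<psi>1 j) * \<psi>0 j) = cnj \<alpha>" by (simp add: \<psi> conj)
    have "(\<Sum>j<e. cnj (\<alpha> * \<psi>0 j + \<beta> * \<psi>1 j) * \<psi>1 j) =
        cnj \<alpha> * (\<Sum>i<e. cnj (\<psi>0 i) * \<psi>1 i) + cnj \<beta> * (\<Sum>i<e. cnj (\<psi>1 i) * \<psi>1 i)"
      unfolding sum_distrib_left sum.distrib[symmetric] by (rule sum.cong[OF refl]) (simp add: algebra_simps)
    then show "(\<Sum>j<e. cnj (\<alpha> * \<psi>0 j + \<beta> * \<psi>1 j) * \<psi>1 j) = cnj \<beta>" by (simp add: \<psi>)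
  qed
  \<comment> \<open>The matrix elements between \<open>\<psi>0\<close> and \<open>\<psi>1\<close>,
    and between \<open>\<psi>0\<close> and itself, turn the recovered projector into the factors
    \<open>\<alpha> * cnj \<beta>\<close> and \<open>\<alpha> * cnj \<alpha>\<close>.\<close>
  note pc = phase_comparison[OF forms[of _ _ \<psi>0 \<psi>1, unfolded ip S_def] forms[of _ _ \<psi>0 \<psi>0, unfolded ip S_def]]
  show "(\<Sum>x<d. \<phi>0 a x * cnj (\<phi>1 b x)) = 0" "(\<Sum>x<d. \<phi>1 a x * cnj (\<phi>0 b x)) = 0"
    "(\<Sum>x<d. \<phi>0 a x * cnj (\<phi>0 b x)) = (\<Sum>x<d. \<phi>1 a x * cnj (\<phi>1 b x))"
    by (rule pc; assumption)+
qed

lemma join_index_complement: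
  assumes "A \<subseteq> N"
  shows "join_index N (N - A) x a = join_index N A a x"
proof -
  have "N - (N - A) = A" using assms by auto
  then show ?thesis unfolding join_index_def by (intro basis_index_cong) auto
qed

lemma reg_dim_physical: "reg_dim {1..n} = 2 ^ n"
  by (simp add: reg_dim_def)

lemma cscalar_prod_sum:
  "v \<in> carrier_vec m \<Longrightarrow> w \<in> carrier_vec m \<Longrightarrow> v \<bullet>c w = (\<Sum>i<m. cnj (w $ i) * v $ i)"
  by (simp add: scalar_prod_def lessThan_atLeast0 mult.commute)

text \<open>Every normalised superposition of \<open>v0\<close> and \<open>v1\<close> is again a
  code state, so recovery holds for all of them. \<open>v $ J a x\<close> is the amplitude with
  \<open>A\<close> in state \<open>a\<close> and its complement in state \<open>x\<close>.\<close>

lemma erasure_correctable_decoupled: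
  assumes EC: "erasure_correctable n S A" and A: "A \<subseteq> {1..n}" and S: "S \<subseteq> carrier_mat (2 ^ n) (2 ^ n)"
    and v0: "v0 \<in> codespace n S" "v0 \<bullet>c v0 = 1" and v1: "v1 \<in> codespace n S" "v1 \<bullet>c v1 = 1"
    and orth: "v1 \<bullet>c v0 = 0" and ab: "a < reg_dim A" "b < reg_dim A"
  defines "J \<equiv> join_index {1..n} A"
  shows "(\<Sum>x<reg_dim ({1..n} - A). v0 $ J a x * cnj (v1 $ J b x)) = 0"
    and "(\<Sum>x<reg_dim ({1..n} - A). v1 $ J a x * cnj (v0 $ J b x)) = 0"
    and "(\<Sum>x<reg_dim ({1..n} - A). v0 $ J a x * cnj (v0 $ J b x)) =
      (\<Sum>x<reg_dim ({1..n} - A). v1 $ J a x * cnj (v1 $ J b x))"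
proof -
  obtain R where R: "quantum_channel (reg_dim ({1..n} - A)) (2 ^ n) R"
    and rec: "\<And>v. v \<in> codespace n S \<Longrightarrow> v \<bullet>c v = 1 \<Longrightarrow> R (reduced_state {1..n} ({1..n} - A) (ket_bra v)) = ket_bra v"
    using EC by (auto simp: erasure_correctable_def)
  have c: "v0 \<in> carrier_vec (2 ^ n)" "v1 \<in> carrier_vec (2 ^ n)" using v0 v1 by (auto simp: codespace_def)
  have J: "J a x < 2 ^ n" for a x using join_index_less[of "{1..n}" A a x] unfolding J_def reg_dim_physical by simp
  have \<psi>: "(\<Sum>i<2 ^ n. cnj (v0 $ i) * v0 $ i) = 1" "(\<Sum>i<2 ^ n. cnj (v1 $ i) * v1 $ i) = 1"
    "(\<Sum>i<2 ^ n. cnj (v0 $ i) * v1 $ i) = 0"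
    using v0(2) v1(2) orth c by (simp_all add: cscalar_prod_sum)
  have conj: "(\<Sum>i<2 ^ n. cnj (v1 $ i) * v0 $ i) = 0"
    using arg_cong[OF \<psi>(3), of cnj] by (simp add: mult.commute)
  have out: "R (Matrix.mat (reg_dim ({1..n} - A)) (reg_dim ({1..n} - A)) (\<lambda>(x, y). \<Sum>a<reg_dim A.
        (\<alpha> * v0 $ J a x + \<beta> * v1 $ J a x) * cnj (\<alpha> * v0 $ J a y + \<beta> * v1 $ J a y))) =
      outer_mat (2 ^ n) (\<lambda>i. \<alpha> * v0 $ i + \<beta> * v1 $ i) (\<lambda>i. \<alpha> * v0 $ i + \<beta> * v1 $ i)"
    if \<alpha>\<beta>: "\<alpha> * cnj \<alpha> + \<beta> * cnj \<beta> = 1" for \<alpha> \<beta>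
  proof -
    define v where "v = \<alpha> \<cdot>\<^sub>v v0 + \<beta> \<cdot>\<^sub>v v1"
    have vc: "v \<in> carrier_vec (2 ^ n)" using c by (simp add: v_def)
    have vi: "v $ i = \<alpha> * v0 $ i + \<beta> * v1 $ i" if "i < 2 ^ n" for i using that c by (simp add: v_def)
    have "v \<in> codespace n S"
    proof -
      have "s *\<^sub>v v = v" if "s \<in> S" for s
      proof -
        have s: "s \<in> carrier_mat (2 ^ n) (2 ^ n)" using that S by auto
        have "s *\<^sub>v v0 = v0" "s *\<^sub>v v1 = v1" using that v0 v1 by (auto simp: codespace_def)
        then show ?thesis unfolding v_def using c s
          by (simp add: mult_add_distrib_mat_vec[OF s] mult_mat_vec[OF s])
      qed
      then show ?thesis using vc by (simp add: codespace_def)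
    qed
    moreover have "v \<bullet>c v = 1"
    proof -
      have "v \<bullet>c v = (\<Sum>i<2 ^ n. cnj (\<alpha> * v0 $ i + \<beta> * v1 $ i) * (\<alpha> * v0 $ i + \<beta> * v1 $ i))"
        unfolding cscalar_prod_sum[OF vc vc] by (intro sum.cong[OF refl]) (simp add: vi)
      also have "\<dots> = \<alpha> * cnj \<alpha> * (\<Sum>i<2 ^ n. cnj (v0 $ i) * v0 $ i) + \<beta> * cnj \<alpha> * (\<Sum>i<2 ^ n. cnj (v0 $ i) * v1 $ i) +
        \<alpha> * cnj \<beta> * (\<Sum>i<2 ^ n. cnj (v1 $ i) * v0 $ i) + \<beta> * cnj \<beta> * (\<Sum>i<2 ^ n. cnj (v1 $ i) * v1 $ i)"
        unfolding sum_distrib_left sum.distrib[symmetric] by (rule sum.cong[OF refl]) (simp add: algebra_simps)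
      finally show ?thesis unfolding \<psi> conj using \<alpha>\<beta> by simp
    qed
    ultimately have "R (reduced_state {1..n} ({1..n} - A) (ket_bra v)) = ket_bra v" by (rule rec)
    moreover have "ket_bra v = outer_mat (2 ^ n) (\<lambda>i. \<alpha> * v0 $ i + \<beta> * v1 $ i) (\<lambda>i. \<alpha> * v0 $ i + \<beta> * v1 $ i)"
      using vc vi by (intro eq_matI) (simp_all add: ket_bra_def)
    moreover have "reduced_state {1..n} ({1..n} - A) (ket_bra v) =
        Matrix.mat (reg_dim ({1..n} - A)) (reg_dim ({1..n} - A)) (\<lambda>(x, y). \<Sum>a<reg_dim A.
        (\<alpha> * v0 $ J a x + \<beta> * v1 $ J a x) * cnj (\<alpha> * v0 $ J a y + \<beta> * v1 $ J a y))" (is "?L = ?M")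
    proof (rule eq_matI)
      fix x y assume "x < dim_row ?M" "y < dim_col ?M"
      then have xy: "x < reg_dim ({1..n} - A)" "y < reg_dim ({1..n} - A)" by auto
      have *: "{1..n} - ({1..n} - A) = A" using A by auto
      show "?L $$ (x, y) = ?M $$ (x, y)"
        unfolding reduced_state_entry[OF xy] * join_index_complement[OF A] J_def[symmetric]
        using xy J vc by (simp add: ket_bra_def vi)
    qed (simp_all add: reduced_state_def Let_def)
    ultimately show ?thesis by simp
  qed
  show "(\<Sum>x<reg_dim ({1..n} - A). v0 $ J a x * cnj (v1 $ J b x)) = 0"
    "(\<Sum>x<reg_dim ({1..n} - A). v1 $ J a x * cnj (v0 $ J b x)) = 0"
    "(\<Sum>x<reg_dim ({1..n} - A). v0 $ J a x * cnj (v0 $ J b x)) =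
      (\<Sum>x<reg_dim ({1..n} - A). v1 $ J a x * cnj (v1 $ J b x))"
    by (rule code_blocks_decoupled[OF R \<psi> out ab]; assumption)+
qed


section \<open>The encoded state\<close>

text \<open>The reduced state of a pure state is a Gram matrix, so its quadratic form is a sum of
  squared moduli over the traced-out index.\<close>

lemma density_mat_reduced_pure:
  assumes Q: "finite Q" "K \<subseteq> Q" and v: "v \<in> carrier_vec (reg_dim Q)" "v \<bullet>c v = 1"
  shows "density_mat (reg_dim K) (reduced_state Q K (ket_bra v))"
proof -
  define J where "J = join_index Q K"
  have entry: "reduced_state Q K (ket_bra v) $$ (i, j) = (\<Sum>e<reg_dim (Q - K). v $ J i e * cnj (v $ J j e))"
    if "i < reg_dim K" "j < reg_dim K" for i j
    unfolding reduced_state_entry[OF that] J_def using v(1) Q(1)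
    by (intro sum.cong[OF refl]) (simp add: ket_bra_def join_index_less)
  have "mat_adjoint (reduced_state Q K (ket_bra v)) = reduced_state Q K (ket_bra v)" (is "?L = ?M")
  proof (rule eq_matI)
    fix i j assume "i < dim_row ?M" "j < dim_col ?M"
    then have ij: "i < reg_dim K" "j < reg_dim K" by (simp_all add: reduced_state_def Let_def)
    then have "?L $$ (i, j) = cnj (?M $$ (j, i))" by (simp add: reduced_state_def Let_def)
    also have "\<dots> = ?M $$ (i, j)" unfolding entry[OF ij] entry[OF ij(2,1)] by (simp add: mult.commute)
    finally show "?L $$ (i, j) = ?M $$ (i, j)" .
  qed (simp_all add: reduced_state_def Let_def)
  moreover have "0 \<le> quad_form (reg_dim K) (reduced_state Q K (ket_bra v)) x" for x
  proof -
    have "quad_form (reg_dim K) (reduced_state Q K (ket_bra v)) x =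
        (\<Sum>a<reg_dim K. \<Sum>b<reg_dim K. \<Sum>e<reg_dim (Q - K). (cnj (x a) * v $ J a e) * cnj (cnj (x b) * v $ J b e))"
      unfolding quad_form_def using entry
      by (intro sum.cong[OF refl]) (simp add: sum_distrib_left mult_ac)
    also have "\<dots> = (\<Sum>a<reg_dim K. \<Sum>e<reg_dim (Q - K). \<Sum>b<reg_dim K. (cnj (x a) * v $ J a e) * cnj (cnj (x b) * v $ J b e))"
      by (rule sum.cong[OF refl], rule sum.swap)
    also have "\<dots> = (\<Sum>e<reg_dim (Q - K). \<Sum>a<reg_dim K. \<Sum>b<reg_dim K. (cnj (x a) * v $ J a e) * cnj (cnj (x b) * v $ J b e))"
      by (rule sum.swap)
    also have "\<dots> = (\<Sum>e<reg_dim (Q - K). (\<Sum>a<reg_dim K. cnj (x a) * v $ J a e) * cnj (\<Sum>a<reg_dim K. cnj (x a) * v $ J a e))"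
      by (simp only: cnj_sum sum_product)
    also have "\<dots> = complex_of_real (\<Sum>e<reg_dim (Q - K). (cmod (\<Sum>a<reg_dim K. cnj (x a) * v $ J a e))\<^sup>2)"
      by (simp only: complex_norm_square of_real_sum)
    finally have eq: "quad_form (reg_dim K) (reduced_state Q K (ket_bra v)) x =
      complex_of_real (\<Sum>e<reg_dim (Q - K). (cmod (\<Sum>a<reg_dim K. cnj (x a) * v $ J a e))\<^sup>2)" .
    show ?thesis
      unfolding eq less_eq_complex_def Re_complex_of_real Im_complex_of_real by (simp add: sum_nonneg)
  qed
  moreover have "(\<Sum>a<reg_dim K. reduced_state Q K (ket_bra v) $$ (a, a)) = 1"
  proof -
    have "(\<Sum>a<reg_dim K. reduced_state Q K (ket_bra v) $$ (a, a)) = (\<Sum>x<reg_dim Q. cnj (v $ x) * v $ x)"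
      unfolding sum_join_index[OF Q] J_def[symmetric]
      by (intro sum.cong[OF refl]) (simp add: entry mult.commute)
    then show ?thesis using v by (simp add: cscalar_prod_sum)
  qed
  ultimately show ?thesis by (simp add: density_mat_def)
qed

lemma reduced_state_target_blocks:
  assumes R: "finite R" "0 \<notin> R"
  shows "reduced_state (insert 0 R) R M = target_block (reg_dim R) M 0 0 + target_block (reg_dim R) M 1 1"
proof (rule eq_matI)
  fix r r' assume "r < dim_row (target_block (reg_dim R) M 0 0 + target_block (reg_dim R) M 1 1)"
    "r' < dim_col (target_block (reg_dim R) M 0 0 + target_block (reg_dim R) M 1 1)"
  then have r: "r < reg_dim R" "r' < reg_dim R" by auto
  have *: "insert 0 R - R = {0}" using R by auto
  have "reg_dim {0} = 2" by (simp add: reg_dim_def)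
  then have "reduced_state (insert 0 R) R M $$ (r, r') = (\<Sum>t<2. M $$ (t + 2 * r, t + 2 * r'))"
    unfolding reduced_state_entry[OF r] * using R r
    by (intro sum.cong) (simp_all add: join_index_target)
  then show "reduced_state (insert 0 R) R M $$ (r, r') =
      (target_block (reg_dim R) M 0 0 + target_block (reg_dim R) M 1 1) $$ (r, r')"
    using r by (simp add: numeral_2_eq_2 lessThan_Suc add.commute)
qed (simp_all add: reduced_state_def Let_def)

section \<open>Operators on the target and dephasing\<close>

lemma on_target_entry:
  assumes R: "finite R" "0 \<notin> R" and ij: "i < 2 * reg_dim R" "j < 2 * reg_dim R"
  shows "on_target R \<sigma> $$ (i, j) = \<sigma> $$ (i mod 2, j mod 2) * of_bool (i div 2 = j div 2)"
proof -
  have div: "i div 2 < reg_dim R" "j div 2 < reg_dim R" using ij by auto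
  have "(\<Prod>q\<in>R. (if q = 0 then \<sigma> else 1\<^sub>m 2) $$ (digit (insert 0 R) i q, digit (insert 0 R) j q)) =
      (\<Prod>q\<in>R. of_bool (digit R (i div 2) q = digit R (j div 2) q))"
  proof (rule prod.cong[OF refl])
    fix q assume q: "q \<in> R"
    then have "q \<noteq> 0" using R by metis
    then show "(if q = 0 then \<sigma> else 1\<^sub>m 2) $$ (digit (insert 0 R) i q, digit (insert 0 R) j q) =
        of_bool (digit R (i div 2) q = digit R (j div 2) q)"
      by (simp add: digit_insert_0'[OF R q])
  qed
  also have "\<dots> = of_bool (i div 2 = j div 2)"
  proof (cases "i div 2 = j div 2")
    case False
    then obtain q where "q \<in> R" "digit R (i div 2) q \<noteq> digit R (j div 2) q"
      using digit_inject[OF R(1) div] by blast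
    then show ?thesis using False R by (auto intro!: prod_zero)
  qed simp
  finally show ?thesis
    using ij R by (simp add: on_target_def tensor_op_def reg_dim_insert_0)
qed

lemma on_target_carrier:
  "finite R \<Longrightarrow> 0 \<notin> R \<Longrightarrow> on_target R \<sigma> \<in> carrier_mat (2 * reg_dim R) (2 * reg_dim R)"
  by (simp add: on_target_def tensor_op_def reg_dim_insert_0)

text \<open>An operator on the target does not change the other qubits, so a matrix product with it
  reduces to a sum over two target values.\<close>

lemma sum_same_div_2:
  fixes f g :: "nat \<Rightarrow> complex"
  assumes "i div 2 < m"
  shows "(\<Sum>l<2 * m. f (l mod 2) * of_bool (i div 2 = l div 2) * g l) = (\<Sum>s<2. f s * g (s + 2 * (i div 2)))"
proof -
  have "(\<Sum>l<2 * m. f (l mod 2) * of_bool (i div 2 = l div 2) * g l) =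
      (\<Sum>s<2. \<Sum>r<m. if r = i div 2 then f s * g (s + 2 * r) else 0)"
    unfolding sum_lessThan_double' by (intro sum.cong[OF refl]) auto
  then show ?thesis using assms by simp
qed

lemma on_target_conj_entry:
  assumes R: "finite R" "0 \<notin> R" and M: "M \<in> carrier_mat (2 * reg_dim R) (2 * reg_dim R)"
    and ij: "i < 2 * reg_dim R" "j < 2 * reg_dim R"
  shows "(on_target R \<sigma> * M * on_target R \<sigma>) $$ (i, j) =
    (\<Sum>s'<2. (\<Sum>s<2. \<sigma> $$ (i mod 2, s) * M $$ (s + 2 * (i div 2), s' + 2 * (j div 2))) * \<sigma> $$ (s', j mod 2))"
proof -
  note T = on_target_carrier[OF R, of \<sigma>]
  have div: "i div 2 < reg_dim R" "j div 2 < reg_dim R" using ij by auto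
  have TM: "(on_target R \<sigma> * M) $$ (i, l) = (\<Sum>s<2. \<sigma> $$ (i mod 2, s) * M $$ (s + 2 * (i div 2), l))"
    if "l < 2 * reg_dim R" for l
  proof -
    have "(on_target R \<sigma> * M) $$ (i, l) =
        (\<Sum>a<2 * reg_dim R. \<sigma> $$ (i mod 2, a mod 2) * of_bool (i div 2 = a div 2) * M $$ (a, l))"
      unfolding index_mult_mat_sum[OF T M ij(1) that]
      by (intro sum.cong[OF refl]) (simp add: on_target_entry[OF R ij(1)])
    also have "\<dots> = (\<Sum>s<2. \<sigma> $$ (i mod 2, s) * M $$ (s + 2 * (i div 2), l))"
      by (rule sum_same_div_2[OF div(1), of "\<lambda>s. \<sigma> $$ (i mod 2, s)" "\<lambda>a. M $$ (a, l)"])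
    finally show ?thesis .
  qed
  have "(on_target R \<sigma> * M * on_target R \<sigma>) $$ (i, j) =
      (\<Sum>l<2 * reg_dim R. \<sigma> $$ (l mod 2, j mod 2) * of_bool (j div 2 = l div 2) * (on_target R \<sigma> * M) $$ (i, l))"
    unfolding index_mult_mat_sum[OF mult_carrier_square_mat[OF T M] T ij]
    by (intro sum.cong[OF refl])
      (auto simp: on_target_entry[OF R _ ij(2)] simp del: index_mult_mat(1))
  also have "\<dots> = (\<Sum>s'<2. \<sigma> $$ (s', j mod 2) * (on_target R \<sigma> * M) $$ (i, s' + 2 * (j div 2)))"
    by (rule sum_same_div_2[OF div(2)])
  also have "\<dots> = (\<Sum>s'<2. (\<Sum>s<2. \<sigma> $$ (i mod 2, s) * M $$ (s + 2 * (i div 2), s' + 2 * (j div 2))) * \<sigma> $$ (s', j mod 2))"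
    using div(2) by (intro sum.cong[OF refl], subst TM) auto
  finally show ?thesis .
qed

lemma sum_less_2: "(\<Sum>t<2 :: nat. f t) = f 0 + (f 1 :: 'a :: comm_monoid_add)"
  by (simp add: numeral_2_eq_2 lessThan_Suc add.commute)

lemma sigma_z_entry:
  "sigma_z $$ (0, 0) = 1" "sigma_z $$ (0, Suc 0) = 0" "sigma_z $$ (Suc 0, 0) = 0" "sigma_z $$ (Suc 0, Suc 0) = - 1"
  by (simp_all add: sigma_z_def mat_of_rows_list_def)

text \<open>These entries determine the conjugation of a block diagonal matrix: the off-diagonal
  phases cancel, so the result is independent of \<open>\<phi>\<close>.\<close>

lemma sigma_phi_entry:
  "sigma_phi \<phi> $$ (0, 0) = 0" "sigma_phi \<phi> $$ (Suc 0, Suc 0) = 0"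
  "sigma_phi \<phi> $$ (0, Suc 0) * sigma_phi \<phi> $$ (Suc 0, 0) = 1"
proof -
  show "sigma_phi \<phi> $$ (0, 0) = 0" "sigma_phi \<phi> $$ (Suc 0, Suc 0) = 0"
    by (simp_all add: sigma_phi_def sigma_x_def sigma_y_def mat_of_rows_list_def)
  have "sigma_phi \<phi> $$ (0, Suc 0) * sigma_phi \<phi> $$ (Suc 0, 0) =
      complex_of_real (cos \<phi> * cos \<phi> + sin \<phi> * sin \<phi>)"
    unfolding of_real_add of_real_mult
    by (simp add: sigma_phi_def sigma_x_def sigma_y_def mat_of_rows_list_def algebra_simps)
  also have "\<dots> = 1" by (simp only: sin_cos_squared_add3 of_real_1)
  finally show "sigma_phi \<phi> $$ (0, Suc 0) * sigma_phi \<phi> $$ (Suc 0, 0) = 1" .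
qed

lemma dephase_entry:
  assumes R: "finite R" "0 \<notin> R" and M: "M \<in> carrier_mat (2 * reg_dim R) (2 * reg_dim R)"
    and ij: "i < 2 * reg_dim R" "j < 2 * reg_dim R"
  shows "dephase R \<sigma> M $$ (i, j) = (M $$ (i, j) + (on_target R \<sigma> * M * on_target R \<sigma>) $$ (i, j)) / 2"
proof -
  define X where "X = on_target R \<sigma> * M * on_target R \<sigma>"
  have "X \<in> carrier_mat (2 * reg_dim R) (2 * reg_dim R)"
    unfolding X_def by (intro mult_carrier_square_mat M on_target_carrier[OF R])
  then show ?thesis using M ij unfolding dephase_def X_def[symmetric] by simp
qed

lemma dephase_carrier:
  assumes R: "finite R" "0 \<notin> R" and M: "M \<in> carrier_mat (2 * reg_dim R) (2 * reg_dim R)"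
  shows "dephase R \<sigma> M \<in> carrier_mat (2 * reg_dim R) (2 * reg_dim R)"
  unfolding dephase_def
  by (intro smult_carrier_mat add_carrier_mat mult_carrier_square_mat M on_target_carrier[OF R])

text \<open>Conjugation by \<open>sigma_z\<close> changes the sign of the off-diagonal target
  blocks, so they cancel in the average.\<close>

lemma dephase_sigma_z:
  assumes R: "finite R" "0 \<notin> R" and M: "M \<in> carrier_mat (2 * reg_dim R) (2 * reg_dim R)"
  shows "dephase R sigma_z M = pinch M"
proof (rule eq_matI)
  fix i j assume "i < dim_row (pinch M)" "j < dim_col (pinch M)"
  then have ij: "i < 2 * reg_dim R" "j < 2 * reg_dim R" using M by (auto simp: pinch_def)
  have eq: "2 * (a div 2) = a" if "a mod 2 = 0" for a :: nat using that by auto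
  have eq': "Suc (2 * (a div 2)) = a" if "a mod 2 = Suc 0" for a :: nat using that mod_mult_div_eq[of a 2] by simp
  have "i mod 2 = 0 \<or> i mod 2 = Suc 0" "j mod 2 = 0 \<or> j mod 2 = Suc 0" by auto
  then show "dephase R sigma_z M $$ (i, j) = pinch M $$ (i, j)"
    unfolding dephase_entry[OF R M ij] on_target_conj_entry[OF R M ij] sum_less_2
    using M ij by (elim disjE) (simp_all add: sigma_z_entry pinch_def eq eq')
qed (use M dephase_carrier[OF R M, of sigma_z] in \<open>auto simp: pinch_def\<close>)

text \<open>Conjugation by \<open>sigma_phi\<close> exchanges the two diagonal blocks; the average
  replaces both weights by \<open>(p 0 + p 1) / 2 = 1 / 2\<close>.\<close>

lemma dephase_sigma_phi_product:
  assumes R: "finite R" "0 \<notin> R" and M: "M \<in> carrier_mat (2 * reg_dim R) (2 * reg_dim R)"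
    and p: "p 0 + p 1 = (1 :: real)"
    and MM: "\<And>t t' r r'. t < 2 \<Longrightarrow> t' < 2 \<Longrightarrow> r < reg_dim R \<Longrightarrow> r' < reg_dim R \<Longrightarrow>
      M $$ (t + 2 * r, t' + 2 * r') = of_bool (t = t') * of_real (p t) * \<sigma> $$ (r, r')"
    and t: "t < 2" "t' < 2" and r: "r < reg_dim R" "r' < reg_dim R"
  shows "dephase R (sigma_phi \<phi>) M $$ (t + 2 * r, t' + 2 * r') = of_bool (t = t') * of_real (1 / 2) * \<sigma> $$ (r, r')"
proof -
  have ij: "t + 2 * r < 2 * reg_dim R" "t' + 2 * r' < 2 * reg_dim R" using t r by auto
  have mods: "(t + 2 * r) mod 2 = t" "(t + 2 * r) div 2 = r" "(t' + 2 * r') mod 2 = t'" "(t' + 2 * r') div 2 = r'"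
    using t by auto
  have MMs: "M $$ (2 * r, 2 * r') = of_real (p 0) * \<sigma> $$ (r, r')" "M $$ (2 * r, Suc (2 * r')) = 0"
    "M $$ (Suc (2 * r), 2 * r') = 0" "M $$ (Suc (2 * r), Suc (2 * r')) = of_real (p 1) * \<sigma> $$ (r, r')"
    using MM[of 0 0 r r'] MM[of 0 1 r r'] MM[of 1 0 r r'] MM[of 1 1 r r'] r by simp_all
  have p': "complex_of_real (p (Suc 0)) = 1 - of_real (p 0)"
    using p by (metis One_nat_def add_diff_cancel_left' of_real_1 of_real_diff)
  define a b where "a = sigma_phi \<phi> $$ (0, Suc 0)" and "b = sigma_phi \<phi> $$ (Suc 0, 0)"
  have ab: "a * b = 1" "b * a = 1" using sigma_phi_entry(3)[of \<phi>] by (simp_all add: a_def b_def mult.commute)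
  have ab': "a * (x * b) = x" "b * (x * a) = x" "a * x * b = x" "b * x * a = x" for x
    using ab by (metis mult.commute mult.left_commute mult_1_right)+
  consider "t = 0 \<and> t' = 0" | "t = 0 \<and> t' = Suc 0" | "t = Suc 0 \<and> t' = 0" | "t = Suc 0 \<and> t' = Suc 0"
    using t by linarith
  then show ?thesis
    unfolding dephase_entry[OF R M ij] on_target_conj_entry[OF R M ij] sum_less_2 mods
    by cases (simp_all add: sigma_phi_entry(1,2) MMs p' ab' flip: a_def b_def, simp_all add: algebra_simps)
qed

text \<open>Put \<open>P = C_par B\<close> and \<open>X = C_perp A - C_perp B\<close>. Then
  \<open>gamma_cap A B\<close> is the minimum of \<open>max X 0\<close> and
  \<open>capacity A - capacity B + P + max (- X) 0\<close>; for either sign of \<open>X\<close> one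
  of them is at most 0. \<open>gamma_cap B A\<close> is the minimum of
  \<open>P + max (- X) 0\<close> and \<open>capacity B - capacity A + max X 0\<close>, both
  nonnegative.\<close>

lemma unique_capacity_eq_0:
  assumes "capacity (insert 0 (A \<union> B)) \<rho> A = C_perp (insert 0 (A \<union> B)) \<rho> A"
    and "C_par (insert 0 (A \<union> B)) \<rho> A = 0" and "0 \<le> C_par (insert 0 (A \<union> B)) \<rho> B"
    and "C_par (insert 0 (A \<union> B)) \<rho> B \<le> capacity (insert 0 (A \<union> B)) \<rho> B - capacity (insert 0 (A \<union> B)) \<rho> A"
  shows "unique_capacity A B \<rho> = 0"
proof -
  define Q where "Q = insert 0 (A \<union> B)"
  have "gamma_cap Q \<rho> A B \<le> 0" "0 \<le> gamma_cap Q \<rho> B A"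
    using assms unfolding gamma_cap_def Delta_cap_def Gamma_cap_def Q_def[symmetric]
    by (simp_all add: max_def min_def)
  then show ?thesis unfolding unique_capacity_def Let_def Q_def[symmetric] by simp
qed

lemma pauli_group_carrier:
  "L \<in> carrier (pauli_group n) \<Longrightarrow> L \<in> carrier_mat (2 ^ n) (2 ^ n)"
  using reg_dim_physical[of n] by (auto simp: pauli_group_def pauli_string_def tensor_op_def)

text \<open>Moving the Hermitian matrix from one side of the inner product to the other equates the
  product with its negative.\<close>

lemma eigenvectors_orthogonal:
  assumes Z: "Z \<in> carrier_mat m m" "mat_adjoint Z = Z"
    and v0: "v0 \<in> carrier_vec m" "Z *\<^sub>v v0 = v0" and v1: "v1 \<in> carrier_vec m" "Z *\<^sub>v v1 = - v1"
  shows "v1 \<bullet>c v0 = (0 :: complex)"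
proof -
  have h: "Z $$ (i, j) = cnj (Z $$ (j, i))" if "i < m" "j < m" for i j
    using arg_cong[OF Z(2), of "\<lambda>M. M $$ (i, j)"] that Z(1) by simp
  have a: "(\<Sum>j<m. Z $$ (i, j) * v0 $ j) = v0 $ i" "(\<Sum>j<m. Z $$ (i, j) * v1 $ j) = - v1 $ i" if "i < m" for i
    using arg_cong[OF v0(2), of "\<lambda>v. v $ i"] arg_cong[OF v1(2), of "\<lambda>v. v $ i"] that Z(1) v0(1) v1(1)
    by (simp_all add: scalar_prod_def lessThan_atLeast0)
  have "- (\<Sum>i<m. cnj (v0 $ i) * v1 $ i) = (\<Sum>i<m. \<Sum>j<m. cnj (v0 $ i) * (Z $$ (i, j) * v1 $ j))"
    by (simp add: a sum_negf flip: sum_distrib_left)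
  also have "\<dots> = (\<Sum>j<m. \<Sum>i<m. cnj (v0 $ i) * (Z $$ (i, j) * v1 $ j))" by (rule sum.swap)
  also have "\<dots> = (\<Sum>j<m. \<Sum>i<m. cnj (Z $$ (j, i) * v0 $ i) * v1 $ j)"
    by (intro sum.cong[OF refl], subst h) (simp_all add: mult_ac)
  also have "\<dots> = (\<Sum>j<m. cnj (v0 $ j) * v1 $ j)"
    by (intro sum.cong[OF refl]) (simp only: sum_distrib_right[symmetric] cnj_sum[symmetric] lessThan_iff a)
  finally have "(\<Sum>i<m. cnj (v0 $ i) * v1 $ i) = 0" by simp
  then show ?thesis using v0 v1 by (simp add: cscalar_prod_sum)
qed

lemma encoded_state_entry:
  assumes v: "v0 \<in> carrier_vec (2 ^ n)" "v1 \<in> carrier_vec (2 ^ n)" and tx: "t < 2" "x < 2 ^ n"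
  shows "encoded_state n lam v0 v1 $ (t + 2 * x) =
    (if t = 0 then complex_of_real (sqrt lam) * v0 $ x else complex_of_real (sqrt (1 - lam)) * v1 $ x)"
proof -
  have N: "{0} \<union> {1..n} = insert 0 {1..n}" by simp
  have dim: "reg_dim (insert 0 {1..n}) = 2 * 2 ^ n" using reg_dim_insert_0[of "{1..n}"] reg_dim_physical[of n] by simp
  have i: "t + 2 * x < 2 * 2 ^ n" "(t + 2 * x) mod 2 = t" "(t + 2 * x) div 2 = x" using tx by auto
  have T: "basis_index {0} (digit (insert 0 {1..n}) (t + 2 * x)) = t"
    using i by (simp add: basis_index_def)
  have "basis_index {1..n} (digit (insert 0 {1..n}) (t + 2 * x)) = basis_index {1..n} (digit {1..n} x)"
    by (intro basis_index_cong) (simp add: digit_insert_0' i(3))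
  also have "\<dots> = x" using tx reg_dim_physical[of n] by (intro basis_index_digit) auto
  finally have P: "basis_index {1..n} (digit (insert 0 {1..n}) (t + 2 * x)) = x" .
  have ten: "tensor_vec {0} {1..n} (unit_vec 2 s) w $ (t + 2 * x) = of_bool (t = s) * w $ x" if "s < 2" for s w
  proof -
    have "tensor_vec {0} {1..n} (unit_vec 2 s) w $ (t + 2 * x) =
        unit_vec 2 s $ basis_index {0} (digit (insert 0 {1..n}) (t + 2 * x)) *
        w $ basis_index {1..n} (digit (insert 0 {1..n}) (t + 2 * x))"
      unfolding tensor_vec_def N dim by (rule index_vec[OF i(1)])
    then show ?thesis unfolding T P using that tx by simp
  qed
  have dims: "dim_vec (tensor_vec {0} {1..n} u w) = 2 * 2 ^ n" for u w
    unfolding tensor_vec_def N dim by simp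
  have "encoded_state n lam v0 v1 $ (t + 2 * x) =
      complex_of_real (sqrt lam) * tensor_vec {0} {1..n} (unit_vec 2 0) v0 $ (t + 2 * x) +
      complex_of_real (sqrt (1 - lam)) * tensor_vec {0} {1..n} (unit_vec 2 1) v1 $ (t + 2 * x)"
    unfolding encoded_state_def using i(1) by (simp add: dims del: One_nat_def)
  also have "\<dots> = (if t = 0 then complex_of_real (sqrt lam) * v0 $ x else complex_of_real (sqrt (1 - lam)) * v1 $ x)"
    using tx(1) by (simp only: ten[of 0] ten[of 1]) (auto simp: less_2_cases_iff ten)
  finally show ?thesis .
qed

theorem mainTheorem3:
  fixes n d :: nat
    and S :: "complex mat set"
    and Zbar Xbar :: "complex mat"
    and v0 v1 :: "complex vec"
    and lam :: real
    and A B :: "nat set"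
  assumes "stabilizer_code n d S"
    and "logical_op n S Zbar" and "logical_op n S Xbar" and "Zbar * Xbar = - (Xbar * Zbar)"
    and "logical_basis n S Zbar v0 v1"
    and "0 \<le> lam" and "lam \<le> 1 / 2"
    and "A \<subseteq> {1..n}" and "A \<noteq> {}" and "erasure_correctable n S A"
    and "B \<subseteq> {1..n}" and "B \<noteq> {}" and "A \<inter> B = {}"
  shows "unique_capacity A B
    (reduced_state {0..n} (insert 0 (A \<union> B)) (ket_bra (encoded_state n lam v0 v1))) = 0"
proof -
  define N where "N = {1..n}"
  have N: "finite N" "0 \<notin> N" "{0..n} = insert 0 N" by (auto simp: N_def)
  have dimN: "reg_dim N = 2 ^ n" unfolding N_def by (rule reg_dim_physical)
  have AN: "A \<subseteq> N" and BN: "B \<subseteq> N" using assms(8,11) by (simp_all add: N_def)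
  have Sc: "S \<subseteq> carrier_mat (2 ^ n) (2 ^ n)"
    using assms(1) subgroup.subset pauli_group_carrier unfolding stabilizer_code_def by blast
  have lb: "v0 \<in> codespace n S" "v0 \<bullet>c v0 = 1" "v1 \<in> codespace n S" "v1 \<bullet>c v1 = 1"
    "Zbar *\<^sub>v v0 = v0" "Zbar *\<^sub>v v1 = - v1"
    using assms(5) by (auto simp: logical_basis_def)
  have vc: "v0 \<in> carrier_vec (2 ^ n)" "v1 \<in> carrier_vec (2 ^ n)" using lb by (auto simp: codespace_def)
  have Zc: "Zbar \<in> carrier_mat (2 ^ n) (2 ^ n)" "mat_adjoint Zbar = Zbar"
    using assms(2) pauli_group_carrier by (auto simp: logical_op_def)
  have orth: "v1 \<bullet>c v0 = 0" by (rule eigenvectors_orthogonal[OF Zc vc(1) lb(5) vc(2) lb(6)])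
  define enc where "enc = encoded_state n lam v0 v1"
  \<comment> \<open>The encoded state in the uniform shape
    \<open>\<Sum>t. c t * (t \<otimes> V t)\<close>, with \<open>p t\<close> the squared modulus of
    \<open>c t\<close>.\<close>
  define c where "c t = complex_of_real (if t = 0 then sqrt lam else sqrt (1 - lam))" for t :: nat
  define V where "V t = (if t = 0 then v0 else v1)" for t :: nat
  define p where "p t = (if t = 0 then lam else 1 - lam)" for t :: nat
  have p0: "0 \<le> p t" for t using assms(6,7) by (simp add: p_def)
  have p1: "p 0 + p 1 = 1" by (simp add: p_def)
  have cc: "cnj (c t) * c t = of_real (p t)" for t
    using assms(6,7) by (simp add: c_def p_def flip: of_real_mult)
  have enc: "enc $ (t + 2 * x) = c t * V t $ x" if "t < 2" "x < 2 ^ n" for t x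
    using encoded_state_entry[OF vc that, of lam] by (simp add: enc_def c_def V_def)
  have Vunit: "(\<Sum>x<2 ^ n. cnj (V t $ x) * V t $ x) = 1" for t
    using lb vc by (simp add: V_def cscalar_prod_sum)
  have dimQ: "reg_dim (insert 0 N) = 2 * 2 ^ n" using N by (simp add: reg_dim_insert_0 dimN)
  have encc: "enc \<in> carrier_vec (reg_dim (insert 0 N))"
  proof -
    have "{0} \<union> {1..n} = insert 0 N" by (auto simp: N_def)
    then show ?thesis unfolding enc_def encoded_state_def tensor_vec_def by simp
  qed
  have "enc \<bullet>c enc = (\<Sum>t<2. \<Sum>x<2 ^ n. cnj (enc $ (t + 2 * x)) * enc $ (t + 2 * x))"
    unfolding cscalar_prod_sum[OF encc encc] dimQ by (rule sum_lessThan_double')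
  also have "\<dots> = (\<Sum>t<2. \<Sum>x<2 ^ n. (cnj (c t) * c t) * (cnj (V t $ x) * V t $ x))"
    by (intro sum.cong[OF refl]) (simp add: enc)
  also have "\<dots> = of_real (p 0 + p 1)"
    unfolding cc by (simp add: sum_less_2 Vunit del: One_nat_def flip: sum_distrib_left)
  finally have encu: "enc \<bullet>c enc = 1" unfolding p1 by simp
  define h where "h = - (\<Sum>t<2. p t * log 2 (p t))"
  \<comment> \<open>\<open>\<tau> R\<close> and \<open>\<sigma> R\<close> are the states of target
    with \<open>R\<close> and of \<open>R\<close> alone, taken directly from the full encoded state;
    \<open>red\<close> identifies them with the reductions of the state of target, \<open>A\<close>
    and \<open>B\<close>.\<close>
  define \<tau> where "\<tau> R = reduced_state {0..n} (insert 0 R) (ket_bra enc)" for R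
  define \<sigma> where "\<sigma> R = reduced_state {0..n} R (ket_bra enc)" for R
  have fin: "finite R" "0 \<notin> R" if "R \<subseteq> N" for R using that N finite_subset by auto
  have \<tau>_density: "density_mat (2 * reg_dim R) (\<tau> R)" if R: "R \<subseteq> N" for R
    using density_mat_reduced_pure[of "insert 0 N" "insert 0 R" enc] N R fin[OF R] encc encu
    by (simp add: \<tau>_def reg_dim_insert_0 subset_insertI2)
  have \<tau>c: "\<tau> R \<in> carrier_mat (2 * reg_dim R) (2 * reg_dim R)" if R: "R \<subseteq> N" for R
    using \<tau>_density[OF R] by (simp add: density_mat_def)
  have \<sigma>_density: "density_mat (reg_dim R) (\<sigma> R)" if R: "R \<subseteq> N" for R
    using density_mat_reduced_pure[of "insert 0 N" R enc] N R encc encu by (auto simp: \<sigma>_def)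
  have \<sigma>: "\<sigma> R = target_block (reg_dim R) (\<tau> R) 0 0 + target_block (reg_dim R) (\<tau> R) 1 1" if R: "R \<subseteq> N" for R
    unfolding reduced_state_target_blocks[OF fin[OF R], symmetric] \<sigma>_def \<tau>_def
    using R N by (intro reduced_state_reduced_state[symmetric]) auto
  have \<tau>: "\<tau> R $$ (t + 2 * r, t' + 2 * r') = c t * cnj (c t') *
      (\<Sum>e<reg_dim (N - R). V t $ join_index N R r e * cnj (V t' $ join_index N R r' e))"
    if R: "R \<subseteq> N" and t: "t < 2" "t' < 2" and r: "r < reg_dim R" "r' < reg_dim R" for R t t' r r'
  proof -
    have i: "t + 2 * r < reg_dim (insert 0 R)" "t' + 2 * r' < reg_dim (insert 0 R)"
      using t r fin[OF R] by (simp_all add: reg_dim_insert_0)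
    have diff: "insert 0 N - insert 0 R = N - R" using N by auto
    have J: "join_index N R a e < 2 ^ n" for a e
      using join_index_less[OF N(1), of R a e] by (simp add: dimN)
    have Q: "t + 2 * join_index N R a e < dim_vec enc" if "t < 2" for t a e
      using encc J[of a e] that by (simp add: dimQ)
    show ?thesis
      unfolding \<tau>_def N(3) reduced_state_entry[OF i] diff
        join_index_insert_0[OF N(1,2) R t(1)] join_index_insert_0[OF N(1,2) R t(2)] sum_distrib_left
      by (intro sum.cong[OF refl]) (simp add: ket_bra_def Q t enc J mult_ac)
  qed
  have tr: "(\<Sum>r<reg_dim R. target_block (reg_dim R) (\<tau> R) t t $$ (r, r)) = complex_of_real (p t)"
    if R: "R \<subseteq> N" and t: "t < 2" for R t
  proof -
    have "(\<Sum>r<reg_dim R. target_block (reg_dim R) (\<tau> R) t t $$ (r, r)) =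
        of_real (p t) * (\<Sum>r<reg_dim R. \<Sum>e<reg_dim (N - R). V t $ join_index N R r e * cnj (V t $ join_index N R r e))"
      by (subst sum_distrib_left, rule sum.cong[OF refl])
        (simp add: \<tau>[OF R t t] mult.commute[of "c t"] cc)
    also have "(\<Sum>r<reg_dim R. \<Sum>e<reg_dim (N - R). V t $ join_index N R r e * cnj (V t $ join_index N R r e)) =
        (\<Sum>x<2 ^ n. V t $ x * cnj (V t $ x))"
      unfolding dimN[symmetric] by (rule sum_join_index[OF N(1) R, symmetric])
    also have "\<dots> = 1" using Vunit[of t] by (simp only: mult.commute)
    finally show ?thesis by simp
  qed
  \<comment> \<open>Subadditivity is applied after pinching, which preserves the diagonal blocks and
    hence both marginal terms of the bound.\<close>
  have sub: "vn_entropy (pinch (\<tau> R)) \<le> vn_entropy (\<sigma> R) + h" if R: "R \<subseteq> N" for R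
    using vn_entropy_subadditive[OF density_mat_pinch[OF \<tau>_density[OF R]], of "\<sigma> R" p]
      tr[OF R] \<sigma>[OF R] target_block_pinch[OF \<tau>c[OF R]]
    by (simp add: h_def)
  have red: "reduced_state (insert 0 (A \<union> B)) R (reduced_state {0..n} (insert 0 (A \<union> B)) (ket_bra enc)) = \<sigma> R"
    "reduced_state (insert 0 (A \<union> B)) (insert 0 R) (reduced_state {0..n} (insert 0 (A \<union> B)) (ket_bra enc)) = \<tau> R"
    if "R = A \<or> R = B" for R
    using that AN BN N unfolding \<sigma>_def \<tau>_def by (auto intro!: reduced_state_reduced_state)
  have prodA: "\<tau> A $$ (t + 2 * r, t' + 2 * r') = of_bool (t = t') * of_real (p t) * \<sigma> A $$ (r, r')"
    if t: "t < 2" "t' < 2" and r: "r < reg_dim A" "r' < reg_dim A" for t t' r r'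
  proof -
    note dec = erasure_correctable_decoupled[OF assms(10,8) Sc lb(1-4) orth r, folded N_def]
    \<comment> \<open>By decoupling, \<open>v1\<close> gives the same overlap and the mixed overlaps
      vanish. Since the weights \<open>p\<close> add up to 1, \<open>s\<close> is the entry of
      \<open>\<sigma> A\<close>.\<close>
    define s where "s = (\<Sum>e<reg_dim (N - A). v0 $ join_index N A r e * cnj (v0 $ join_index N A r' e))"
    have \<tau>s: "\<tau> A $$ (t + 2 * r, t' + 2 * r') = of_bool (t = t') * of_real (p t) * s" if "t < 2" "t' < 2" for t t'
      using that dec unfolding \<tau>[OF AN that r] cc[symmetric]
      by (auto simp: V_def s_def less_2_cases_iff)
    have "\<sigma> A $$ (r, r') = \<tau> A $$ (0 + 2 * r, 0 + 2 * r') + \<tau> A $$ (1 + 2 * r, 1 + 2 * r')"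
      unfolding \<sigma>[OF AN] using r by simp
    also have "\<dots> = of_real (p 0 + p 1) * s"
      by (subst (1 2) \<tau>s) (simp_all add: distrib_right)
    finally have "\<sigma> A $$ (r, r') = s" unfolding p1 by simp
    then show ?thesis using \<tau>s[OF t] by simp
  qed
  have HA: "vn_entropy (\<tau> A) = vn_entropy (\<sigma> A) + h"
    using vn_entropy_product[OF \<sigma>_density[OF AN] \<tau>c[OF AN] p0 prodA] p1
    by (simp add: sum_less_2 h_def)
  have pinchA: "pinch (\<tau> A) = \<tau> A"
  proof (rule eq_matI)
    fix a b assume "a < dim_row (\<tau> A)" "b < dim_col (\<tau> A)"
    then have "a < 2 * reg_dim A" "b < 2 * reg_dim A" using \<tau>c[OF AN] by auto
    then show "pinch (\<tau> A) $$ (a, b) = \<tau> A $$ (a, b)"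
      using prodA[of "a mod 2" "b mod 2" "a div 2" "b div 2"] \<tau>c[OF AN] by (auto simp: pinch_def)
  qed (simp_all add: pinch_def)
  \<comment> \<open>The uniform target weights contribute one bit for every \<open>\<phi>\<close>,
    so the average in \<open>C_perp\<close> is that of a constant.\<close>
  have HphiA: "vn_entropy (dephase A (sigma_phi \<phi>) (\<tau> A)) = vn_entropy (\<sigma> A) + 1" for \<phi>
  proof -
    have "vn_entropy (dephase A (sigma_phi \<phi>) (\<tau> A)) =
        (\<Sum>t<2 :: nat. 1 / 2) * vn_entropy (\<sigma> A) - (\<Sum>t<2 :: nat. 1 / 2 * log 2 (1 / 2))"
      using dephase_sigma_phi_product[OF fin[OF AN] \<tau>c[OF AN] p1 prodA]
      by (intro vn_entropy_product[OF \<sigma>_density[OF AN] dephase_carrier[OF fin[OF AN] \<tau>c[OF AN]]]) auto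
    then show ?thesis by (simp add: log_divide)
  qed
  define Q where "Q = insert 0 (A \<union> B)"
  define \<rho> where "\<rho> = reduced_state {0..n} Q (ket_bra enc)"
  have capacity: "capacity Q \<rho> R = 1 + vn_entropy (\<sigma> R) - vn_entropy (\<tau> R)" if "R = A \<or> R = B" for R
    unfolding capacity_def \<rho>_def Q_def red[OF that] ..
  have coherence: "coherence Q \<rho> R s = vn_entropy (dephase R s (\<tau> R)) - vn_entropy (\<tau> R)" if "R = A \<or> R = B" for R s
    unfolding coherence_def \<rho>_def Q_def red[OF that] ..
  have par: "C_par Q \<rho> R = vn_entropy (pinch (\<tau> R)) - vn_entropy (\<tau> R)" if "R = A \<or> R = B" for R
  proof -
    have "R \<subseteq> N" using that AN BN by auto
    then show ?thesis unfolding C_par_def coherence[OF that] by (simp add: dephase_sigma_z fin \<tau>c)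
  qed
  have perpA: "C_perp Q \<rho> A = 1 - h"
    unfolding C_perp_def by (simp add: coherence HphiA HA)
  have "unique_capacity A B \<rho> = 0"
  proof (rule unique_capacity_eq_0[of A B \<rho>, folded Q_def])
    show "capacity Q \<rho> A = C_perp Q \<rho> A" unfolding perpA by (simp add: capacity HA)
    show "C_par Q \<rho> A = 0" by (simp add: par pinchA)
    show "0 \<le> C_par Q \<rho> B" using vn_entropy_pinch[OF \<tau>_density[OF BN]] by (simp add: par)
    \<comment> \<open>\<open>capacity A\<close> equals \<open>1 - h\<close>, so this is the bound
      \<open>sub\<close> on the pinched entropy with the entropy of \<open>\<tau> B\<close>
      subtracted.\<close>
    show "C_par Q \<rho> B \<le> capacity Q \<rho> B - capacity Q \<rho> A"
      using sub[OF BN] by (simp add: par capacity HA)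
  qed
  then show ?thesis unfolding \<rho>_def Q_def enc_def .
qed

end
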